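(* Let $n\ge 2$ be an integer and let $k\ge 0$ be an integer. Let $V(n,k)$ and $H(n,k)$ be the number of coverings in $\mathbf{T}_n$ with exactly $k$ vertical dominoes and exactly $k$ horizontal dominoes, respectively. Define $$ W(n,k) := 2\sum_{i=1}^{\left\lfloor \frac{n-1}{2}\right\rfloor}\ \left(\sum_{k_1+k_2 = k-(n-i-1)} S(n-i-2,k_1)\,S(i-1,k_2)\right) + \sum_{k_1+k_2=k} S\!\left(\left\lfloor\tfrac{n-2}{2}\right\rfloor,k_1\right) S\!\left(\left\lfloor\tfrac{n-2}{2}\right\rfloor,k_2\right), $$ where the inner sums range over pairs of integers $(k_1,k_2)$ with the indicated sum. If $n$ is even, then $V(n,k)=W(n,k)$. If $n$ is odd, then $H(n,k)=W(n,k)$.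
   Context: A tatami covering of the $n\times n$ grid is an exact covering of the grid, without overlaps, by $1\times 1$ monominoes, $1\times 2$ horizontal dominoes (one row, two columns) and $2\times 1$ vertical dominoes (two rows, one column), placed on grid squares, in which no four tiles meet (i.e. no point is a common corner of four distinct tiles). $\mathbf{T}_n$ denotes the set of tatami coverings of the $n\times n$ grid with exactly $n$ monominoes that have a monomino in the top left corner and a monomino in the top right corner. Coverings are counted as fixed objects (not up to symmetry). For integers $s\ge 0$ and $k$, $S(s,k)$ is the number of subsets of $\{1,2,\ldots,s\}$ whose elements sum to $k$ (so $S(s,k)=0$ for $k<0$, and $S(0,0)=1$). *)

theory Defs
  imports Main
begin

text \<open>
  Grid squares are pairs (row, column) counted from 0 at the top left. Grid points are
  addressed likewise: the square (r, c) has the four corners {r, r + 1} x {c, c + 1}.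
  A tile is named by its top left square.
\<close>

datatype tile =
    Monomino nat nat
  | HDomino nat nat
  | VDomino nat nat

fun cells :: "tile \<Rightarrow> (nat \<times> nat) set" where
  "cells (Monomino r c) = {(r, c)}"
| "cells (HDomino r c) = {(r, c), (r, c + 1)}"
| "cells (VDomino r c) = {(r, c), (r + 1, c)}"

fun corners :: "tile \<Rightarrow> (nat \<times> nat) set" where
  "corners (Monomino r c) = {r, r + 1} \<times> {c, c + 1}"
| "corners (HDomino r c) = {r, r + 1} \<times> {c, c + 2}"
| "corners (VDomino r c) = {r, r + 2} \<times> {c, c + 1}"

definition grid :: "nat \<Rightarrow> (nat \<times> nat) set" where
  "grid n = {0..<n} \<times> {0..<n}"

definition covering :: "nat \<Rightarrow> tile set \<Rightarrow> bool" where
  "covering n C \<longleftrightarrow>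
     (\<Union>t\<in>C. cells t) = grid n \<and>
     (\<forall>t\<in>C. \<forall>u\<in>C. t \<noteq> u \<longrightarrow> cells t \<inter> cells u = {})"

definition tatami_covering :: "nat \<Rightarrow> tile set \<Rightarrow> bool" where
  "tatami_covering n C \<longleftrightarrow>
     covering n C \<and>
     \<not> (\<exists>p. \<exists>U\<subseteq>C. card U = 4 \<and> (\<forall>t\<in>U. p \<in> corners t))"

definition monominoes :: "tile set \<Rightarrow> tile set" where
  "monominoes C = {t \<in> C. \<exists>r c. t = Monomino r c}"

definition hdominoes :: "tile set \<Rightarrow> tile set" where
  "hdominoes C = {t \<in> C. \<exists>r c. t = HDomino r c}"

definition vdominoes :: "tile set \<Rightarrow> tile set" where
  "vdominoes C = {t \<in> C. \<exists>r c. t = VDomino r c}"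

definition T :: "nat \<Rightarrow> tile set set" where
  "T n = {C. tatami_covering n C \<and> card (monominoes C) = n \<and>
             Monomino 0 0 \<in> C \<and> Monomino 0 (n - 1) \<in> C}"

definition V :: "nat \<Rightarrow> nat \<Rightarrow> nat" where
  "V n k = card {C \<in> T n. card (vdominoes C) = k}"

definition H :: "nat \<Rightarrow> nat \<Rightarrow> nat" where
  "H n k = card {C \<in> T n. card (hdominoes C) = k}"

definition S :: "nat \<Rightarrow> int \<Rightarrow> nat" where
  "S s k = card {A. A \<subseteq> {1..s} \<and> int (\<Sum>A) = k}"

lemma S_neg: "S s k = 0" if "k < 0"
proof -
  have "0 \<le> int (\<Sum>A)" for A :: "nat set"
    by (rule of_nat_0_le_iff)
  then have "int (\<Sum>A) \<noteq> k" for A :: "nat set"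
    using that by (metis linorder_not_less)
  then show ?thesis
    by (simp add: S_def)
qed

text \<open>
  The sum of S s k1 * S t k2 over all integers k1, k2 with k1 + k2 = m. Terms with a negative
  k1 or k2 vanish; leaving them out makes the index set finite, as the sum operator returns 0
  on infinite sets.
\<close>

definition S_conv :: "nat \<Rightarrow> nat \<Rightarrow> int \<Rightarrow> nat" where
  "S_conv s t m =
     (\<Sum>(k1, k2) | 0 \<le> k1 \<and> 0 \<le> k2 \<and> k1 + k2 = m. S s k1 * S t k2)"

text \<open>
  For n \<ge> 2 and i in the range of the outer sum, no natural number subtraction truncates.
\<close>

definition W :: "nat \<Rightarrow> nat \<Rightarrow> nat" where
  "W n k =
     2 * (\<Sum>i = 1..(n - 1) div 2. S_conv (n - i - 2) (i - 1) (int k - (int n - int i - 1)))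
     + S_conv ((n - 2) div 2) ((n - 2) div 2) (int k)"

end

theory Submission
  imports Defs
begin

text \<open>
  Every domino touches, with the midpoints of its two long sides, two corners of each of its
  cells. Let a domino cell point along its antidiagonal and along its diagonal to these two
  corners: an upper half of a vertical domino points south-west and south-east, a left half of a
  horizontal domino points north-east and south-east, and so on; a monomino points nowhere. Four
  tiles do not meet at an interior point exactly if some long side is centred there, so of the two
  cells that adjoin the point on its antidiagonal one points to it, and likewise on its diagonal.
  Hence, of two consecutive cells of a line, the first points forward or the second points
  backward, and so at least one end cell of every line with at least two cells points inward.

  Counting the inward pointing ends over the frame of an N x N square, and regarding the halves of
  the dominoes that the frame cuts off from the inner square of side N - 2 as monominoes there,
  gives: number of monominoes + excess = number of monominoes of the inner square + 2, where the
  excess counts the lines both of whose ends point inward (mono_count_frame). By induction there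
  are at most N monominoes (mono_count_le), and N monominoes force excess 0. Then all
  cells of a line point the same way, apart from monominoes at its ends: the covering is given by
  one bit per antidiagonal and one bit per diagonal, and the monominoes are the cells whose common
  direction leads out of the grid (maximal_field_is_arrow_field).

  Index antidiagonals by p = r + c and diagonals by q = r + (n - 1 - c); reflecting the columns
  exchanges the two. Monominoes in the top corners say that the two central lines p = n - 1 and
  q = n - 1 point north. The cells on the central lines then make antidiagonals 2t - 1 and 2t
  opposite, and likewise diagonals 2t - 1 and 2t. Compare with the covering by horizontal dominoes
  (n even) or by vertical dominoes (n odd): what remains is a choice of bands {2t - 1, 2t}, not
  containing n - 1, that are flipped. Apart from the central one, there is one antidiagonal band
  and one diagonal band of each length a in {1..n - 2}, and flipping such a band creates a dominoes
  of the other orientation. Where a flipped antidiagonal and a flipped diagonal crossed, the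
  original orientation would reappear and propagate to a central line, which is not flipped
  (no_crossing); bands of lengths a and b cross exactly if a + b \<ge> n - 1. So the coverings
  correspond to the pairs (X, Y) of subsets of {1..n - 2} with a + b \<le> n - 2 for a in X and b in
  Y, and the dominoes of the other orientation number \<Sum>X + \<Sum>Y (T_eq_flips,
  card_vdominoes_flipped, card_hdominoes_flipped). At most one of X and Y
  has an element above (n - 2) div 2; sorting by its maximum gives W (card_flips_eq_W).
\<close>

section \<open>Tatami fields\<close>

text \<open>
The entry of a cell tells in which direction the other half of its domino lies.
\<close>

datatype dir = Mono | Up | Dn | Lf | Rt

text \<open>
The last clause is the tatami condition at an interior point, stated for the diagonal through it;
the condition on the antidiagonal follows from the matching of domino halves.
\<close>

definition tatami_field :: "nat \<Rightarrow> (nat \<Rightarrow> nat \<Rightarrow> dir) \<Rightarrow> bool" where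
  "tatami_field n f \<longleftrightarrow> (\<forall>r<n. \<forall>c<n.
     (f r c = Rt \<longrightarrow> Suc c < n \<and> f r (Suc c) = Lf) \<and>
     (f r c = Lf \<longrightarrow> (\<exists>c'. c = Suc c' \<and> f r c' = Rt)) \<and>
     (f r c = Dn \<longrightarrow> Suc r < n \<and> f (Suc r) c = Up) \<and>
     (f r c = Up \<longrightarrow> (\<exists>r'. r = Suc r' \<and> f r' c = Dn)) \<and>
     (Suc r < n \<longrightarrow> Suc c < n \<longrightarrow> f r c \<in> {Rt, Dn} \<or> f (Suc r) (Suc c) \<in> {Lf, Up}))"

lemma tatami_fieldD:
  assumes "tatami_field n f" "r < n" "c < n"
  shows "f r c = Rt \<Longrightarrow> Suc c < n \<and> f r (Suc c) = Lf"
    and "f r c = Lf \<Longrightarrow> \<exists>c'. c = Suc c' \<and> f r c' = Rt"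
    and "f r c = Dn \<Longrightarrow> Suc r < n \<and> f (Suc r) c = Up"
    and "f r c = Up \<Longrightarrow> \<exists>r'. r = Suc r' \<and> f r' c = Dn"
  using assms by (auto simp: tatami_field_def)

lemma tatami_field_diagonal:
  assumes "tatami_field n f" "Suc r < n" "Suc c < n"
  shows "f r c \<in> {Rt, Dn} \<or> f (Suc r) (Suc c) \<in> {Lf, Up}"
  using assms by (auto simp: tatami_field_def)

lemma tatami_field_antidiagonal:
  assumes "tatami_field n f" "Suc r < n" "Suc c < n"
  shows "f (Suc r) c \<in> {Rt, Up} \<or> f r (Suc c) \<in> {Lf, Dn}"
  using tatami_field_diagonal[OF assms]
    tatami_fieldD[OF assms(1), of r c] tatami_fieldD[OF assms(1), of "Suc r" "Suc c"] assms(2,3)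
  by (auto dest: Suc_lessD)

section \<open>Coverings and tatami fields\<close>

text \<open>
A domino is recorded at its top left cell, that is, at its right or downward pointing half.
\<close>

definition tiles :: "nat \<Rightarrow> (nat \<Rightarrow> nat \<Rightarrow> dir) \<Rightarrow> tile set" where
  "tiles n f = {t. case t of
      Monomino r c \<Rightarrow> r < n \<and> c < n \<and> f r c = Mono
    | HDomino r c \<Rightarrow> r < n \<and> c < n \<and> f r c = Rt
    | VDomino r c \<Rightarrow> r < n \<and> c < n \<and> f r c = Dn}"

lemma in_tiles [simp]:
  "Monomino r c \<in> tiles n f \<longleftrightarrow> r < n \<and> c < n \<and> f r c = Mono"
  "HDomino r c \<in> tiles n f \<longleftrightarrow> r < n \<and> c < n \<and> f r c = Rt"
  "VDomino r c \<in> tiles n f \<longleftrightarrow> r < n \<and> c < n \<and> f r c = Dn"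
  by (simp_all add: tiles_def)

fun tile_at :: "(nat \<Rightarrow> nat \<Rightarrow> dir) \<Rightarrow> nat \<times> nat \<Rightarrow> tile" where
  "tile_at f (r, c) = (case f r c of Mono \<Rightarrow> Monomino r c | Rt \<Rightarrow> HDomino r c | Dn \<Rightarrow> VDomino r c
     | Lf \<Rightarrow> HDomino r (c - 1) | Up \<Rightarrow> VDomino (r - 1) c)"

lemma tiles_cong:
  assumes "\<And>r c. r < n \<Longrightarrow> c < n \<Longrightarrow> f r c = g r c"
  shows "tiles n f = tiles n g"
  unfolding tiles_def using assms by (auto split: tile.splits)

lemma tile_at_cell:
  assumes t: "tatami_field n f" and "u \<in> tiles n f" "z \<in> cells u"
  shows "z \<in> grid n \<and> tile_at f z = u"
  using assms(2,3) tatami_fieldD[OF t] by (cases u) (auto simp: grid_def)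

lemma tile_at_in_tiles:
  assumes t: "tatami_field n f" and "z \<in> grid n"
  shows "tile_at f z \<in> tiles n f \<and> z \<in> cells (tile_at f z)"
proof -
  obtain r c where z: "z = (r, c)" "r < n" "c < n" using assms(2) by (auto simp: grid_def)
  show ?thesis using tatami_fieldD[OF t z(2,3)] z by (cases "f r c") auto
qed

lemma covering_tiles:
  assumes t: "tatami_field n f"
  shows "covering n (tiles n f)"
  unfolding covering_def
proof (intro conjI ballI impI)
  show "(\<Union>u\<in>tiles n f. cells u) = grid n"
    using tile_at_cell[OF t] tile_at_in_tiles[OF t] by blast
  show "cells u \<inter> cells v = {}" if "u \<in> tiles n f" "v \<in> tiles n f" "u \<noteq> v" for u v
    using tile_at_cell[OF t] that by blast
qed

lemma corner_tile:
  assumes t: "tatami_field n f" and u: "u \<in> tiles n f" and p: "(i, j) \<in> corners u"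
  obtains z where "z \<in> grid n" "u = tile_at f z" "fst z = i \<or> Suc (fst z) = i" "snd z = j \<or> Suc (snd z) = j"
proof -
  have "\<exists>z. z \<in> cells u \<and> (fst z = i \<or> Suc (fst z) = i) \<and> (snd z = j \<or> Suc (snd z) = j)"
    using p by (cases u) auto
  then show thesis using tile_at_cell[OF t u] that by blast
qed

text \<open>
A tile with corner p occupies a grid cell next to p. Four such tiles would need all four cells
around p, in four different tiles; but the tatami condition joins two of these cells.
\<close>

lemma tatami_covering_tiles:
  assumes t: "tatami_field n f"
  shows "tatami_covering n (tiles n f)"
  unfolding tatami_covering_def
proof (intro conjI notI covering_tiles[OF t])
  assume "\<exists>p. \<exists>U\<subseteq>tiles n f. card U = 4 \<and> (\<forall>t\<in>U. p \<in> corners t)"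
  then obtain p U where pU: "U \<subseteq> tiles n f" "card U = 4" "\<forall>u\<in>U. p \<in> corners u"
    by blast
  obtain i j where "p = (i, j)" by (cases p)
  with pU have U: "U \<subseteq> tiles n f" "card U = 4" "\<And>u. u \<in> U \<Longrightarrow> (i, j) \<in> corners u"
    by blast+
  \<comment> \<open>The cells of the grid around the point (i, j); on the border of the grid there are fewer than four.\<close>
  define Z where "Z = {z \<in> grid n. (fst z = i \<or> Suc (fst z) = i) \<and> (snd z = j \<or> Suc (snd z) = j)}"
  have UZ: "U \<subseteq> tile_at f ` Z"
  proof
    fix u assume "u \<in> U"
    then show "u \<in> tile_at f ` Z"
      using corner_tile[OF t, of u i j] U unfolding Z_def by blast
  qed
  have sub: "Z \<subseteq> {i - 1, i} \<times> {j - 1, j}" by (auto simp: Z_def)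
  have fin: "finite Z" using finite_subset[OF sub] by simp
  have "4 \<le> card (tile_at f ` Z)" using card_mono[OF _ UZ] U(2) fin by simp
  moreover have "card (tile_at f ` Z) \<le> card Z" by (rule card_image_le[OF fin])
  moreover have "card Z \<le> card ({i - 1, i} \<times> {j - 1, j})" by (rule card_mono[OF _ sub]) simp
  moreover have "card ({i - 1, i} \<times> {j - 1, j}) = card {i - 1, i} * card {j - 1, j}"
    by (rule card_cartesian_product)
  moreover have "card {i - 1, i} \<le> 2" "card {j - 1, j} \<le> 2" by (simp_all add: card_insert_if)
  ultimately have four: "card (tile_at f ` Z) = card Z" "card Z = card ({i - 1, i} \<times> {j - 1, j})"
    using mult_le_mono[of "card {i - 1, i}" 2 "card {j - 1, j}" 2] by linarith+
  have inj: "inj_on (tile_at f) Z" using four(1) fin by (simp add: eq_card_imp_inj_on)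
  have Z: "Z = {i - 1, i} \<times> {j - 1, j}" using card_subset_eq[OF _ sub] four(2) by simp
  have "i \<noteq> 0" "j \<noteq> 0"
  proof -
    show "i \<noteq> 0"
    proof
      assume "i = 0"
      then have "card ({i - 1, i} \<times> {j - 1, j}) \<le> 2"
        by (simp add: card_cartesian_product card_insert_if)
      then show False using \<open>4 \<le> card (tile_at f ` Z)\<close> four by simp
    qed
    show "j \<noteq> 0"
    proof
      assume "j = 0"
      then have "card ({i - 1, i} \<times> {j - 1, j}) \<le> 2"
        by (simp add: card_cartesian_product card_insert_if)
      then show False using \<open>4 \<le> card (tile_at f ` Z)\<close> four by simp
    qed
  qed
  then obtain r c where rc: "i = Suc r" "j = Suc c" by (meson not0_implies_Suc)
  have in_Z: "(r, c) \<in> Z" "(Suc r, c) \<in> Z" "(r, Suc c) \<in> Z" "(Suc r, Suc c) \<in> Z"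
    using Z rc by auto
  then have lt: "Suc r < n" "Suc c < n" by (auto simp: Z_def grid_def)
  note D = tatami_fieldD[OF t, of r c] tatami_fieldD[OF t, of "Suc r" "Suc c"]
  have "tile_at f (r, c) = tile_at f (r, Suc c) \<or> tile_at f (r, c) = tile_at f (Suc r, c)
      \<or> tile_at f (Suc r, Suc c) = tile_at f (r, Suc c) \<or> tile_at f (Suc r, Suc c) = tile_at f (Suc r, c)"
    using tatami_field_diagonal[OF t lt] D lt by auto
  then show False using inj_on_eq_iff[OF inj] in_Z by (auto simp del: tile_at.simps)
qed

text \<open>
In a covering the case Up remains for the lower halves of vertical dominoes only, since every cell
is covered.
\<close>

definition field_of :: "tile set \<Rightarrow> nat \<Rightarrow> nat \<Rightarrow> dir" where
  "field_of P r c =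
    (if Monomino r c \<in> P then Mono else if HDomino r c \<in> P then Rt
     else if VDomino r c \<in> P then Dn else if 0 < c \<and> HDomino r (c - 1) \<in> P then Lf else Up)"

lemma covering_unique:
  assumes "covering n P" "u \<in> P" "v \<in> P" "z \<in> cells u" "z \<in> cells v"
  shows "u = v"
  using assms unfolding covering_def by blast

lemma field_of_cell:
  assumes P: "covering n P" and rc: "r < n" "c < n"
  shows "tile_at (field_of P) (r, c) \<in> P \<and> (r, c) \<in> cells (tile_at (field_of P) (r, c))
    \<and> (field_of P r c = Lf \<longrightarrow> 0 < c) \<and> (field_of P r c = Up \<longrightarrow> 0 < r)"
proof -
  have "(r, c) \<in> (\<Union>t\<in>P. cells t)" using P rc by (auto simp: covering_def grid_def)
  then obtain u where u: "u \<in> P" "(r, c) \<in> cells u" by blast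
  then show ?thesis
    by (cases u) (auto simp: field_of_def split: if_splits)
qed

lemma field_of_eq:
  assumes P: "covering n P"
  shows "Monomino r c \<in> P \<Longrightarrow> field_of P r c = Mono"
    and "HDomino r c \<in> P \<Longrightarrow> field_of P r c = Rt" and "HDomino r c \<in> P \<Longrightarrow> field_of P r (Suc c) = Lf"
    and "VDomino r c \<in> P \<Longrightarrow> field_of P r c = Dn" and "VDomino r c \<in> P \<Longrightarrow> field_of P (Suc r) c = Up"
proof -
  have *: "u = v" if "u \<in> P" "z \<in> cells u" "v \<in> P" "z \<in> cells v" for u v z
    using covering_unique[OF P] that by blast
  show "Monomino r c \<in> P \<Longrightarrow> field_of P r c = Mono" by (simp add: field_of_def)
  show "HDomino r c \<in> P \<Longrightarrow> field_of P r c = Rt"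
    using *[of "HDomino r c" "(r, c)" "Monomino r c"] by (auto simp: field_of_def)
  show "HDomino r c \<in> P \<Longrightarrow> field_of P r (Suc c) = Lf"
    using *[of "HDomino r c" "(r, Suc c)" "Monomino r (Suc c)"]
      *[of "HDomino r c" "(r, Suc c)" "HDomino r (Suc c)"]
      *[of "HDomino r c" "(r, Suc c)" "VDomino r (Suc c)"] by (auto simp: field_of_def)
  show "VDomino r c \<in> P \<Longrightarrow> field_of P r c = Dn"
    using *[of "VDomino r c" "(r, c)" "Monomino r c"]
      *[of "VDomino r c" "(r, c)" "HDomino r c"] by (auto simp: field_of_def)
  show "VDomino r c \<in> P \<Longrightarrow> field_of P (Suc r) c = Up"
    using *[of "VDomino r c" "(Suc r, c)" "Monomino (Suc r) c"]
      *[of "VDomino r c" "(Suc r, c)" "HDomino (Suc r) c"]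
      *[of "VDomino r c" "(Suc r, c)" "VDomino (Suc r) c"]
      *[of "VDomino r c" "(Suc r, c)" "HDomino (Suc r) (c - 1)"] by (auto simp: field_of_def)
qed

lemma tiles_field_of:
  assumes P: "covering n P"
  shows "tiles n (field_of P) = P"
proof (intro set_eqI)
  fix u
  have "u \<in> P \<Longrightarrow> cells u \<subseteq> grid n" using P by (auto simp: covering_def)
  then have in_grid: "u \<in> P \<Longrightarrow> z \<in> cells u \<Longrightarrow> z \<in> grid n" for z by blast
  show "u \<in> tiles n (field_of P) \<longleftrightarrow> u \<in> P"
  proof (cases u)
    case (Monomino r c)
    then show ?thesis
      using in_grid[of "(r, c)"] field_of_eq(1)[OF P, of r c] field_of_cell[OF P, of r c]
      by (auto simp: grid_def)
  next
    case (HDomino r c)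
    then show ?thesis
      using in_grid[of "(r, c)"] field_of_eq(2)[OF P, of r c] field_of_cell[OF P, of r c]
      by (auto simp: grid_def)
  next
    case (VDomino r c)
    then show ?thesis
      using in_grid[of "(r, c)"] field_of_eq(4)[OF P, of r c] field_of_cell[OF P, of r c]
      by (auto simp: grid_def)
  qed
qed

text \<open>
If the tatami condition failed at an interior point, no two of the four cells around it would
belong to one tile, and the four tiles of these cells would meet there.
\<close>

lemma tatami_field_of:
  assumes "tatami_covering n P"
  shows "tatami_field n (field_of P)"
  unfolding tatami_field_def
proof (intro allI impI conjI)
  fix r c assume rc: "r < n" "c < n"
  have P: "covering n P" using assms by (simp add: tatami_covering_def)
  note cell = field_of_cell[OF P] and eq = field_of_eq[OF P]
  have sub: "cells u \<subseteq> grid n" if "u \<in> P" for u using P that by (auto simp: covering_def)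
  show "field_of P r c = Rt \<Longrightarrow> Suc c < n" "field_of P r c = Rt \<Longrightarrow> field_of P r (Suc c) = Lf"
    using cell[OF rc] eq(3)[of r c] sub[of "HDomino r c"] by (auto simp: grid_def)
  show "field_of P r c = Dn \<Longrightarrow> Suc r < n" "field_of P r c = Dn \<Longrightarrow> field_of P (Suc r) c = Up"
    using cell[OF rc] eq(5)[of r c] sub[of "VDomino r c"] by (auto simp: grid_def)
  show "field_of P r c = Lf \<Longrightarrow> \<exists>c'. c = Suc c' \<and> field_of P r c' = Rt"
    using cell[OF rc] eq(2)[of r "c - 1"] by (cases c) auto
  show "field_of P r c = Up \<Longrightarrow> \<exists>r'. r = Suc r' \<and> field_of P r' c = Dn"
    using cell[OF rc] eq(4)[of "r - 1" c] by (cases r) auto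
  show "field_of P r c \<in> {Rt, Dn} \<or> field_of P (Suc r) (Suc c) \<in> {Lf, Up}"
    if lt: "Suc r < n" "Suc c < n"
  proof (rule ccontr)
    assume no: "\<not> ?thesis"
    let ?g = "field_of P"
    define a b d e where "a = tile_at ?g (r, c)" and "b = tile_at ?g (r, Suc c)"
      and "d = tile_at ?g (Suc r, c)" and "e = tile_at ?g (Suc r, Suc c)"
    have A: "?g r c \<in> {Mono, Lf, Up}" and E: "?g (Suc r) (Suc c) \<in> {Mono, Rt, Dn}"
      using no by (cases "?g r c"; cases "?g (Suc r) (Suc c)"; simp)+
    note ca = cell[OF rc] and cb = cell[of r "Suc c", OF rc(1) lt(2)]
      and cd = cell[of "Suc r" c, OF lt(1) rc(2)] and ce = cell[OF lt]
    have B: "?g r (Suc c) \<in> {Mono, Up, Rt}"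
      using cb A E eq(2)[of r c] eq(5)[of r "Suc c"] by (cases "?g r (Suc c)") auto
    have D: "?g (Suc r) c \<in> {Mono, Lf, Dn}"
      using cd A E eq(4)[of r c] eq(3)[of "Suc r" c] by (cases "?g (Suc r) c") auto
    have inP: "{a, b, d, e} \<subseteq> P" using ca cb cd ce unfolding a_def b_def d_def e_def by blast
    note defs = a_def b_def d_def e_def
    have "(Suc r, Suc c) \<in> corners a" using A ca unfolding a_def by auto
    moreover have "(Suc r, Suc c) \<in> corners b" using B cb unfolding b_def by auto
    moreover have "(Suc r, Suc c) \<in> corners d" using D cd unfolding d_def by auto
    moreover have "(Suc r, Suc c) \<in> corners e" using E ce unfolding e_def by auto
    ultimately have corner: "\<forall>t\<in>{a, b, d, e}. (Suc r, Suc c) \<in> corners t" by blast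
    have "a \<noteq> b" using A B unfolding a_def b_def by auto
    moreover have "a \<noteq> d" using A D unfolding a_def d_def by auto
    moreover have "a \<noteq> e" using A E unfolding a_def e_def by auto
    moreover have "b \<noteq> d" using B D ca cb cd unfolding b_def d_def by auto
    moreover have "b \<noteq> e" using B E unfolding b_def e_def by auto
    moreover have "d \<noteq> e" using D E unfolding d_def e_def by auto
    ultimately have "card {a, b, d, e} = 4" by simp
    then show False using assms inP corner unfolding tatami_covering_def by blast
  qed
qed

section \<open>Lines and the frame of the square\<close>

text \<open>
If every gap between consecutive cells has a neighbour pointing to it, then a first cell that does
not point forward makes the second cell point backward; this one does not point forward either,
and so on. The second part is the mirror image.
\<close>

lemma line_word:
  fixes fwd bwd :: "nat \<Rightarrow> bool"
  assumes "\<And>i. i < k \<Longrightarrow> fwd i \<or> bwd (Suc i)" and "\<And>i. \<not> (fwd i \<and> bwd i)"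
  shows "\<not> fwd 0 \<Longrightarrow> 0 < i \<Longrightarrow> i \<le> k \<Longrightarrow> bwd i"
    and "\<not> bwd k \<Longrightarrow> i < k \<Longrightarrow> fwd i"
proof -
  show "bwd i" if "\<not> fwd 0" "0 < i" "i \<le> k"
    using that(2,3)
  proof (induction i)
    case (Suc i)
    then show ?case using assms(1)[of i] assms(2)[of i] that(1) by (cases i) auto
  qed simp
  show "fwd i" if "\<not> bwd k" "i < k"
    using that(2)
  proof (induction "k - i" arbitrary: i)
    case (Suc d)
    show ?case
    proof (cases "Suc i = k")
      case True
      then show ?thesis using assms(1)[of i] that(1) Suc by auto
    next
      case False
      then have "fwd (Suc i)" using Suc by auto
      then show ?thesis using assms(1)[of i] assms(2)[of "Suc i"] Suc by auto
    qed
  qed simp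
qed

lemma antidiagonal_word:
  assumes "tatami_field n f" "a + k < n"
  shows "f (a + k) a \<notin> {Rt, Up} \<Longrightarrow> 0 < i \<Longrightarrow> i \<le> k \<Longrightarrow> f (a + k - i) (a + i) \<in> {Lf, Dn}"
    and "f a (a + k) \<notin> {Lf, Dn} \<Longrightarrow> i < k \<Longrightarrow> f (a + k - i) (a + i) \<in> {Rt, Up}"
proof -
  have step: "f (a + k - i) (a + i) \<in> {Rt, Up} \<or> f (a + k - Suc i) (a + Suc i) \<in> {Lf, Dn}"
    if "i < k" for i
    using tatami_field_antidiagonal[OF assms(1), of "a + k - Suc i" "a + i"] that assms(2)
    by (simp add: Suc_diff_Suc)
  have excl: "\<not> (f (a + k - i) (a + i) \<in> {Rt, Up} \<and> f (a + k - i) (a + i) \<in> {Lf, Dn})" for i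
    by auto
  note w = line_word[where fwd = "\<lambda>i. f (a + k - i) (a + i) \<in> {Rt, Up}"
      and bwd = "\<lambda>i. f (a + k - i) (a + i) \<in> {Lf, Dn}", OF step excl]
  show "f (a + k) a \<notin> {Rt, Up} \<Longrightarrow> 0 < i \<Longrightarrow> i \<le> k \<Longrightarrow> f (a + k - i) (a + i) \<in> {Lf, Dn}"
    using w(1)[of k i] by simp
  show "f a (a + k) \<notin> {Lf, Dn} \<Longrightarrow> i < k \<Longrightarrow> f (a + k - i) (a + i) \<in> {Rt, Up}"
    using w(2)[of k i] by simp
qed

lemma diagonal_word:
  assumes "tatami_field n f" "a + k < n" "b + k < n"
  shows "f a b \<notin> {Rt, Dn} \<Longrightarrow> 0 < i \<Longrightarrow> i \<le> k \<Longrightarrow> f (a + i) (b + i) \<in> {Lf, Up}"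
    and "f (a + k) (b + k) \<notin> {Lf, Up} \<Longrightarrow> i < k \<Longrightarrow> f (a + i) (b + i) \<in> {Rt, Dn}"
proof -
  have step: "f (a + i) (b + i) \<in> {Rt, Dn} \<or> f (a + Suc i) (b + Suc i) \<in> {Lf, Up}"
    if "i < k" for i
    using tatami_field_diagonal[OF assms(1), of "a + i" "b + i"] that assms(2,3) by simp
  have excl: "\<not> (f (a + i) (b + i) \<in> {Rt, Dn} \<and> f (a + i) (b + i) \<in> {Lf, Up})" for i
    by auto
  note w = line_word[where fwd = "\<lambda>i. f (a + i) (b + i) \<in> {Rt, Dn}"
      and bwd = "\<lambda>i. f (a + i) (b + i) \<in> {Lf, Up}", OF step excl]
  show "f a b \<notin> {Rt, Dn} \<Longrightarrow> 0 < i \<Longrightarrow> i \<le> k \<Longrightarrow> f (a + i) (b + i) \<in> {Lf, Up}"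
    using w(1)[of k i] by simp
  show "f (a + k) (b + k) \<notin> {Lf, Up} \<Longrightarrow> i < k \<Longrightarrow> f (a + i) (b + i) \<in> {Rt, Dn}"
    using w(2)[of k i] by simp
qed

definition mono_count :: "nat \<Rightarrow> (nat \<Rightarrow> nat \<Rightarrow> dir) \<Rightarrow> int" where
  "mono_count n f = (\<Sum>r<n. \<Sum>c<n. of_bool (f r c = Mono))"

text \<open>
The restriction to the square without its outer frame; a domino cut by the frame leaves a
monomino.
\<close>

definition inner :: "nat \<Rightarrow> (nat \<Rightarrow> nat \<Rightarrow> dir) \<Rightarrow> nat \<Rightarrow> nat \<Rightarrow> dir" where
  "inner n f r c =
    (let d = f (Suc r) (Suc c)
     in if d = Up \<and> r = 0 \<or> d = Dn \<and> Suc r = n \<or> d = Lf \<and> c = 0 \<or> d = Rt \<and> Suc c = n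
        then Mono else d)"

lemma tatami_field_inner:
  assumes "tatami_field (Suc (Suc n)) f"
  shows "tatami_field n (inner n f)"
  unfolding tatami_field_def
proof (intro allI impI conjI)
  fix r c assume rc: "r < n" "c < n"
  note D = tatami_fieldD[OF assms, of "Suc r" "Suc c"]
  show "inner n f r c = Rt \<Longrightarrow> Suc c < n"
    using D(1) rc by (auto simp: inner_def Let_def split: if_splits)
  show "inner n f r c = Rt \<Longrightarrow> inner n f r (Suc c) = Lf"
    using D(1) rc by (auto simp: inner_def Let_def split: if_splits)
  show "inner n f r c = Lf \<Longrightarrow> \<exists>c'. c = Suc c' \<and> inner n f r c' = Rt"
    using D(2) rc by (cases c) (auto simp: inner_def Let_def split: if_splits)
  show "inner n f r c = Dn \<Longrightarrow> Suc r < n"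
    using D(3) rc by (auto simp: inner_def Let_def split: if_splits)
  show "inner n f r c = Dn \<Longrightarrow> inner n f (Suc r) c = Up"
    using D(3) rc by (auto simp: inner_def Let_def split: if_splits)
  show "inner n f r c = Up \<Longrightarrow> \<exists>r'. r = Suc r' \<and> inner n f r' c = Dn"
    using D(4) rc by (cases r) (auto simp: inner_def Let_def split: if_splits)
  show "inner n f r c \<in> {Rt, Dn} \<or> inner n f (Suc r) (Suc c) \<in> {Lf, Up}"
    if "Suc r < n" "Suc c < n"
  proof -
    have "f (Suc r) (Suc c) = Rt \<or> f (Suc r) (Suc c) = Dn
        \<or> f (Suc (Suc r)) (Suc (Suc c)) = Lf \<or> f (Suc (Suc r)) (Suc (Suc c)) = Up"
      using tatami_field_diagonal[OF assms, of "Suc r" "Suc c"] rc that by simp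
    then show ?thesis
      using that by (elim disjE) (simp_all add: inner_def Let_def)
  qed
qed

text \<open>
For each of the 4n + 2 lines with at least two cells in the square of side n + 2, the number of
end cells that point inward, minus one. The first two sums and the fifth term run over the
antidiagonals, the others over the diagonals.
\<close>

definition excess :: "nat \<Rightarrow> (nat \<Rightarrow> nat \<Rightarrow> dir) \<Rightarrow> int" where
  "excess n f =
     (\<Sum>j<n. of_bool (f (Suc j) 0 \<in> {Rt, Up}) + of_bool (f 0 (Suc j) \<in> {Lf, Dn}) - 1)
   + (\<Sum>j<n. of_bool (f (Suc n) (Suc j) \<in> {Rt, Up}) + of_bool (f (Suc j) (Suc n) \<in> {Lf, Dn}) - 1)
   + (\<Sum>j<n. of_bool (f (Suc j) 0 \<in> {Rt, Dn}) + of_bool (f (Suc n) (n - j) \<in> {Lf, Up}) - 1)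
   + (\<Sum>j<n. of_bool (f 0 (Suc j) \<in> {Rt, Dn}) + of_bool (f (n - j) (Suc n) \<in> {Lf, Up}) - 1)
   + (of_bool (f (Suc n) 0 \<in> {Rt, Up}) + of_bool (f 0 (Suc n) \<in> {Lf, Dn}) - 1)
   + (of_bool (f 0 0 \<in> {Rt, Dn}) + of_bool (f (Suc n) (Suc n) \<in> {Lf, Up}) - 1)"

lemma sum_frame:
  fixes g :: "nat \<Rightarrow> nat \<Rightarrow> int"
  shows "(\<Sum>r<Suc (Suc n). \<Sum>c<Suc (Suc n). g r c) =
    (\<Sum>r<n. \<Sum>c<n. g (Suc r) (Suc c))
    + (\<Sum>j<n. g 0 (Suc j)) + (\<Sum>j<n. g (Suc n) (Suc j))
    + (\<Sum>j<n. g (Suc j) 0) + (\<Sum>j<n. g (Suc j) (Suc n))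
    + g 0 0 + g 0 (Suc n) + g (Suc n) 0 + g (Suc n) (Suc n)"
proof -
  have one: "(\<Sum>j<Suc (Suc n). h j) = h 0 + (\<Sum>j<n. h (Suc j)) + h (Suc n)" for h :: "nat \<Rightarrow> int"
    by (subst sum.lessThan_Suc, subst sum.lessThan_Suc_shift) simp
  show ?thesis
    by (simp only: one sum.distrib)
qed

lemma mono_count_inner:
  assumes "tatami_field (Suc (Suc n)) f"
  shows "mono_count n (inner n f) = (\<Sum>r<n. \<Sum>c<n. of_bool (f (Suc r) (Suc c) = Mono))
    + (\<Sum>j<n. of_bool (f 0 (Suc j) = Dn)) + (\<Sum>j<n. of_bool (f (Suc n) (Suc j) = Up))
    + (\<Sum>j<n. of_bool (f (Suc j) 0 = Rt)) + (\<Sum>j<n. of_bool (f (Suc j) (Suc n) = Lf))"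
proof -
  have cell: "of_bool (inner n f r c = Mono) = (of_bool (f (Suc r) (Suc c) = Mono)
      + (if r = 0 then of_bool (f 0 (Suc c) = Dn) else 0)
      + (if r = n - 1 then of_bool (f (Suc n) (Suc c) = Up) else 0)
      + (if c = 0 then of_bool (f (Suc r) 0 = Rt) else 0)
      + (if c = n - 1 then of_bool (f (Suc r) (Suc n) = Lf) else 0) :: int)"
    if rc: "r < n" "c < n" for r c
  proof -
    note D = tatami_fieldD[OF assms, of "Suc r" "Suc c"]
    have 1: "(if r = 0 then of_bool (f 0 (Suc c) = Dn) else 0 :: int)
        = of_bool (r = 0 \<and> f (Suc r) (Suc c) = Up)"
      using D(4) tatami_fieldD(3)[OF assms, of 0 "Suc c"] rc by auto
    have 2: "(if Suc r = n then of_bool (f (Suc n) (Suc c) = Up) else 0 :: int)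
        = of_bool (Suc r = n \<and> f (Suc r) (Suc c) = Dn)"
      using D(3) tatami_fieldD(4)[OF assms, of "Suc n" "Suc c"] rc by auto
    have 3: "(if c = 0 then of_bool (f (Suc r) 0 = Rt) else 0 :: int)
        = of_bool (c = 0 \<and> f (Suc r) (Suc c) = Lf)"
      using D(2) tatami_fieldD(1)[OF assms, of "Suc r" 0] rc by auto
    have 4: "(if Suc c = n then of_bool (f (Suc r) (Suc n) = Lf) else 0 :: int)
        = of_bool (Suc c = n \<and> f (Suc r) (Suc c) = Rt)"
      using D(1) tatami_fieldD(2)[OF assms, of "Suc r" "Suc n"] rc by auto
    have e: "r = n - 1 \<longleftrightarrow> Suc r = n" "c = n - 1 \<longleftrightarrow> Suc c = n" using rc by auto
    show ?thesis
      unfolding e 1 2 3 4 inner_def Let_def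
      by (cases "f (Suc r) (Suc c)") simp_all
  qed
  have "mono_count n (inner n f) = (\<Sum>r<n. \<Sum>c<n. (of_bool (f (Suc r) (Suc c) = Mono)
      + (if r = 0 then of_bool (f 0 (Suc c) = Dn) else 0)
      + (if r = n - 1 then of_bool (f (Suc n) (Suc c) = Up) else 0)
      + (if c = 0 then of_bool (f (Suc r) 0 = Rt) else 0)
      + (if c = n - 1 then of_bool (f (Suc r) (Suc n) = Lf) else 0) :: int))"
    unfolding mono_count_def by (intro sum.cong refl cell) auto
  moreover have "(\<Sum>r<n. \<Sum>c<n. if r = k then g c else 0) = (\<Sum>j<n. g j)"
    if "n \<noteq> 0 \<Longrightarrow> k < n" for g :: "nat \<Rightarrow> int" and k
    by (subst sum.swap) (use that in \<open>cases "n = 0"; simp add: sum.delta\<close>)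
  moreover have "(\<Sum>r<n. \<Sum>c<n. if c = k then g r else 0) = (\<Sum>j<n. g j)"
    if "n \<noteq> 0 \<Longrightarrow> k < n" for g :: "nat \<Rightarrow> int" and k
    using that by (cases "n = 0") (simp_all add: sum.delta)
  ultimately show ?thesis
    by (simp add: sum.distrib)
qed

text \<open>
A cell of the frame that is not a corner is an end of two lines with at least two cells. It points
inward along both of them if its domino leads into the inner square, along one if its domino lies
within the frame, and along none if it is a monomino. A corner is an end of one such line only, and
points inward unless it is a monomino. Dominoes that lead into the inner square are exactly those
that become monominoes there.
\<close>

lemma mono_count_frame:
  assumes t: "tatami_field (Suc (Suc n)) f"
  shows "mono_count (Suc (Suc n)) f + excess n f = mono_count n (inner n f) + 2"
proof -
  note D = tatami_fieldD[OF t]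
  have rev: "(\<Sum>j<n. g (n - j)) = (\<Sum>j<n. g (Suc j))" for g :: "nat \<Rightarrow> int"
    by (rule sum.reindex_bij_witness[of _ "\<lambda>j. n - Suc j" "\<lambda>j. n - Suc j"]) (auto simp: Suc_diff_Suc)
  have add_sums: "(\<Sum>j<n. a j) + (\<Sum>j<n. b j) = int n + (\<Sum>j<n. d j) - (\<Sum>j<n. e j)"
    if "\<And>j. j < n \<Longrightarrow> a j + b j = 1 + d j - e j" for a b d e :: "nat \<Rightarrow> int"
  proof -
    have "(\<Sum>j<n. a j + b j) = (\<Sum>j<n. 1 + d j - e j)"
      by (rule sum.cong) (auto simp: that)
    then show ?thesis by (simp add: sum.distrib sum_subtractf)
  qed
  have left: "of_bool (f (Suc j) 0 \<in> {Rt, Up}) + of_bool (f (Suc j) 0 \<in> {Rt, Dn})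
      = (1 + of_bool (f (Suc j) 0 = Rt) - of_bool (f (Suc j) 0 = Mono) :: int)" if "j < n" for j
    using D[of "Suc j" 0] that by (cases "f (Suc j) 0") auto
  have top: "of_bool (f 0 (Suc j) \<in> {Lf, Dn}) + of_bool (f 0 (Suc j) \<in> {Rt, Dn})
      = (1 + of_bool (f 0 (Suc j) = Dn) - of_bool (f 0 (Suc j) = Mono) :: int)" if "j < n" for j
    using D[of 0 "Suc j"] that by (cases "f 0 (Suc j)") auto
  have bot: "of_bool (f (Suc n) (Suc j) \<in> {Rt, Up}) + of_bool (f (Suc n) (Suc j) \<in> {Lf, Up})
      = (1 + of_bool (f (Suc n) (Suc j) = Up) - of_bool (f (Suc n) (Suc j) = Mono) :: int)"
    if "j < n" for j
    using D[of "Suc n" "Suc j"] that by (cases "f (Suc n) (Suc j)") auto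
  have right: "of_bool (f (Suc j) (Suc n) \<in> {Lf, Dn}) + of_bool (f (Suc j) (Suc n) \<in> {Lf, Up})
      = (1 + of_bool (f (Suc j) (Suc n) = Lf) - of_bool (f (Suc j) (Suc n) = Mono) :: int)"
    if "j < n" for j
    using D[of "Suc j" "Suc n"] that by (cases "f (Suc j) (Suc n)") auto
  have sums:
    "(\<Sum>j<n. of_bool (f (Suc j) 0 \<in> {Rt, Up})) + (\<Sum>j<n. of_bool (f (Suc j) 0 \<in> {Rt, Dn}))
      = int n + (\<Sum>j<n. of_bool (f (Suc j) 0 = Rt)) - (\<Sum>j<n. of_bool (f (Suc j) 0 = Mono))"
    "(\<Sum>j<n. of_bool (f 0 (Suc j) \<in> {Lf, Dn})) + (\<Sum>j<n. of_bool (f 0 (Suc j) \<in> {Rt, Dn}))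
      = int n + (\<Sum>j<n. of_bool (f 0 (Suc j) = Dn)) - (\<Sum>j<n. of_bool (f 0 (Suc j) = Mono))"
    "(\<Sum>j<n. of_bool (f (Suc n) (Suc j) \<in> {Rt, Up})) + (\<Sum>j<n. of_bool (f (Suc n) (Suc j) \<in> {Lf, Up}))
      = int n + (\<Sum>j<n. of_bool (f (Suc n) (Suc j) = Up)) - (\<Sum>j<n. of_bool (f (Suc n) (Suc j) = Mono))"
    "(\<Sum>j<n. of_bool (f (Suc j) (Suc n) \<in> {Lf, Dn})) + (\<Sum>j<n. of_bool (f (Suc j) (Suc n) \<in> {Lf, Up}))
      = int n + (\<Sum>j<n. of_bool (f (Suc j) (Suc n) = Lf)) - (\<Sum>j<n. of_bool (f (Suc j) (Suc n) = Mono))"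
    by (rule add_sums; rule left top bot right; assumption)+
  have corners:
    "of_bool (f (Suc n) 0 \<in> {Rt, Up}) = (1 - of_bool (f (Suc n) 0 = Mono) :: int)"
    "of_bool (f 0 (Suc n) \<in> {Lf, Dn}) = (1 - of_bool (f 0 (Suc n) = Mono) :: int)"
    "of_bool (f 0 0 \<in> {Rt, Dn}) = (1 - of_bool (f 0 0 = Mono) :: int)"
    "of_bool (f (Suc n) (Suc n) \<in> {Lf, Up}) = (1 - of_bool (f (Suc n) (Suc n) = Mono) :: int)"
    subgoal using D[of "Suc n" 0] by (cases "f (Suc n) 0") auto
    subgoal using D[of 0 "Suc n"] by (cases "f 0 (Suc n)") auto
    subgoal using D[of 0 0] by (cases "f 0 0") auto
    subgoal using D[of "Suc n" "Suc n"] by (cases "f (Suc n) (Suc n)") auto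
    done
  show ?thesis
    unfolding mono_count_inner[OF t] mono_count_def[of "Suc (Suc n)"] sum_frame excess_def
      sum.distrib sum_subtractf corners
      rev[of "\<lambda>k. of_bool (f (Suc n) k \<in> {Lf, Up})"] rev[of "\<lambda>k. of_bool (f k (Suc n) \<in> {Lf, Up})"]
    using sums by (simp del: sum_of_bool_eq)
qed

text \<open>
If the first end does not point inward, then by propagation all other cells of the line point
towards it, the last one included.
\<close>

lemma line_end_points_inward:
  assumes t: "tatami_field (Suc (Suc n)) f"
  shows "j < n \<Longrightarrow> f (Suc j) 0 \<in> {Rt, Up} \<or> f 0 (Suc j) \<in> {Lf, Dn}"
    and "j < n \<Longrightarrow> f (Suc n) (Suc j) \<in> {Rt, Up} \<or> f (Suc j) (Suc n) \<in> {Lf, Dn}"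
    and "j < n \<Longrightarrow> f (Suc j) 0 \<in> {Rt, Dn} \<or> f (Suc n) (n - j) \<in> {Lf, Up}"
    and "j < n \<Longrightarrow> f 0 (Suc j) \<in> {Rt, Dn} \<or> f (n - j) (Suc n) \<in> {Lf, Up}"
    and "f (Suc n) 0 \<in> {Rt, Up} \<or> f 0 (Suc n) \<in> {Lf, Dn}"
    and "f 0 0 \<in> {Rt, Dn} \<or> f (Suc n) (Suc n) \<in> {Lf, Up}"
proof -
  have anti: "f (a + k) a \<in> {Rt, Up} \<or> f a (a + k) \<in> {Lf, Dn}" if "0 < k" "a + k < Suc (Suc n)" for a k
    using antidiagonal_word(1)[OF t that(2), of k] that by auto
  have diag: "f a b \<in> {Rt, Dn} \<or> f (a + k) (b + k) \<in> {Lf, Up}"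
    if "0 < k" "a + k < Suc (Suc n)" "b + k < Suc (Suc n)" for a b k
    using diagonal_word(1)[OF t that(2,3), of k] that by auto
  show "f (Suc j) 0 \<in> {Rt, Up} \<or> f 0 (Suc j) \<in> {Lf, Dn}" if "j < n"
    using anti[of "Suc j" 0] that by simp
  show "f (Suc n) (Suc j) \<in> {Rt, Up} \<or> f (Suc j) (Suc n) \<in> {Lf, Dn}" if "j < n"
    using anti[of "n - j" "Suc j"] that by simp
  show "f (Suc j) 0 \<in> {Rt, Dn} \<or> f (Suc n) (n - j) \<in> {Lf, Up}" if "j < n"
    using diag[of "n - j" "Suc j" 0] that by simp
  show "f 0 (Suc j) \<in> {Rt, Dn} \<or> f (n - j) (Suc n) \<in> {Lf, Up}" if "j < n"
    using diag[of "n - j" 0 "Suc j"] that by simp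
  show "f (Suc n) 0 \<in> {Rt, Up} \<or> f 0 (Suc n) \<in> {Lf, Dn}"
    using anti[of "Suc n" 0] by simp
  show "f 0 0 \<in> {Rt, Dn} \<or> f (Suc n) (Suc n) \<in> {Lf, Up}"
    using diag[of "Suc n" 0 0] by simp
qed

lemma of_bool_pair_excess:
  "P \<or> Q \<Longrightarrow> of_bool P + of_bool Q - 1 = (of_bool (P \<and> Q) :: int)"
  by auto

lemma excess_eq:
  assumes t: "tatami_field (Suc (Suc n)) f"
  shows "excess n f =
     (\<Sum>j<n. of_bool (f (Suc j) 0 \<in> {Rt, Up} \<and> f 0 (Suc j) \<in> {Lf, Dn}))
   + (\<Sum>j<n. of_bool (f (Suc n) (Suc j) \<in> {Rt, Up} \<and> f (Suc j) (Suc n) \<in> {Lf, Dn}))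
   + (\<Sum>j<n. of_bool (f (Suc j) 0 \<in> {Rt, Dn} \<and> f (Suc n) (n - j) \<in> {Lf, Up}))
   + (\<Sum>j<n. of_bool (f 0 (Suc j) \<in> {Rt, Dn} \<and> f (n - j) (Suc n) \<in> {Lf, Up}))
   + of_bool (f (Suc n) 0 \<in> {Rt, Up} \<and> f 0 (Suc n) \<in> {Lf, Dn})
   + of_bool (f 0 0 \<in> {Rt, Dn} \<and> f (Suc n) (Suc n) \<in> {Lf, Up})"
  unfolding excess_def
  by (intro arg_cong2[where f = "(+)"] sum.cong refl of_bool_pair_excess line_end_points_inward[OF t]) auto

lemma excess_nonneg: "tatami_field (Suc (Suc n)) f \<Longrightarrow> 0 \<le> excess n f"
  unfolding excess_eq by (intro add_nonneg_nonneg sum_nonneg) auto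

lemma mono_count_le:
  assumes "tatami_field n f"
  shows "mono_count n f \<le> int n"
  using assms
proof (induction n arbitrary: f rule: induct_nat_012)
  case 1
  then show ?case by (simp add: mono_count_def)
next
  case 0
  then show ?case by (simp add: mono_count_def)
next
  case (ge2 n)
  have "mono_count n (inner n f) \<le> int n"
    using ge2.IH(1) tatami_field_inner[OF ge2.prems] by blast
  with mono_count_frame[OF ge2.prems] excess_nonneg[OF ge2.prems] show ?case by simp
qed

lemma line_end_points_outward:
  assumes t: "tatami_field (Suc (Suc n)) f" and "excess n f = 0"
  shows "j < n \<Longrightarrow> f (Suc j) 0 \<notin> {Rt, Up} \<or> f 0 (Suc j) \<notin> {Lf, Dn}"
    and "j < n \<Longrightarrow> f (Suc n) (Suc j) \<notin> {Rt, Up} \<or> f (Suc j) (Suc n) \<notin> {Lf, Dn}"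
    and "j < n \<Longrightarrow> f (Suc j) 0 \<notin> {Rt, Dn} \<or> f (Suc n) (n - j) \<notin> {Lf, Up}"
    and "j < n \<Longrightarrow> f 0 (Suc j) \<notin> {Rt, Dn} \<or> f (n - j) (Suc n) \<notin> {Lf, Up}"
    and "f (Suc n) 0 \<notin> {Rt, Up} \<or> f 0 (Suc n) \<notin> {Lf, Dn}"
    and "f 0 0 \<notin> {Rt, Dn} \<or> f (Suc n) (Suc n) \<notin> {Lf, Up}"
proof -
  have ge: "0 \<le> (\<Sum>j<n. of_bool (P j) :: int)" for P by (simp add: sum_nonneg)
  have z: "(\<Sum>j<n. of_bool (P j) :: int) = 0 \<Longrightarrow> j < n \<Longrightarrow> \<not> P j" for P j
    by (subst (asm) sum_nonneg_eq_0_iff) auto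
  have ob: "0 \<le> (of_bool P :: int)" "(of_bool P :: int) = 0 \<longleftrightarrow> \<not> P" for P by auto
  note eq = assms(2)[unfolded excess_eq[OF t]]
  have add0: "a + b = 0 \<longleftrightarrow> a = 0 \<and> b = 0" if "0 \<le> a" "0 \<le> b" for a b :: int
    using that by linarith
  note eq' = eq[unfolded add0[OF add_nonneg_nonneg[OF add_nonneg_nonneg[OF add_nonneg_nonneg[OF
    add_nonneg_nonneg[OF ge ge] ge] ge] ob(1)] ob(1)]
    add0[OF add_nonneg_nonneg[OF add_nonneg_nonneg[OF add_nonneg_nonneg[OF ge ge] ge] ge] ob(1)]
    add0[OF add_nonneg_nonneg[OF add_nonneg_nonneg[OF ge ge] ge] ge]
    add0[OF add_nonneg_nonneg[OF ge ge] ge] add0[OF ge ge] ob(2)]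
  note c = eq'[THEN conjunct1, THEN conjunct1]
  show "j < n \<Longrightarrow> f (Suc j) 0 \<notin> {Rt, Up} \<or> f 0 (Suc j) \<notin> {Lf, Dn}"
    using z[OF c[THEN conjunct1, THEN conjunct1, THEN conjunct1]] by blast
  show "j < n \<Longrightarrow> f (Suc n) (Suc j) \<notin> {Rt, Up} \<or> f (Suc j) (Suc n) \<notin> {Lf, Dn}"
    using z[OF c[THEN conjunct1, THEN conjunct1, THEN conjunct2]] by blast
  show "j < n \<Longrightarrow> f (Suc j) 0 \<notin> {Rt, Dn} \<or> f (Suc n) (n - j) \<notin> {Lf, Up}"
    using z[OF c[THEN conjunct1, THEN conjunct2]] by blast
  show "j < n \<Longrightarrow> f 0 (Suc j) \<notin> {Rt, Dn} \<or> f (n - j) (Suc n) \<notin> {Lf, Up}"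
    using z[OF c[THEN conjunct2]] by blast
  show "f (Suc n) 0 \<notin> {Rt, Up} \<or> f 0 (Suc n) \<notin> {Lf, Dn}" using eq' by blast
  show "f 0 0 \<notin> {Rt, Dn} \<or> f (Suc n) (Suc n) \<notin> {Lf, Up}" using eq' by blast
qed

lemma monominoes_tiles: "int (card (monominoes (tiles n f))) = mono_count n f"
proof -
  have "monominoes (tiles n f) = (\<lambda>(r, c). Monomino r c) ` {(r, c). r < n \<and> c < n \<and> f r c = Mono}"
    by (auto simp: monominoes_def image_iff)
  then have "card (monominoes (tiles n f)) = card {(r, c). r < n \<and> c < n \<and> f r c = Mono}"
    by (simp add: card_image inj_on_def)
  also have "{(r, c). r < n \<and> c < n \<and> f r c = Mono} = Sigma {..<n} (\<lambda>r. {c. c < n \<and> f r c = Mono})"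
    by auto
  also have "int (card \<dots>) = mono_count n f"
    by (simp add: mono_count_def Collect_conj_eq Int_commute lessThan_def[symmetric])
  finally show ?thesis by simp
qed

lemma tiles_inject:
  assumes "tatami_field n f" "tatami_field n g" "tiles n f = tiles n g" "r < n" "c < n"
  shows "f r c = g r c"
proof -
  have z: "(r, c) \<in> grid n" using assms by (simp add: grid_def)
  have "tile_at f (r, c) \<in> tiles n g" "(r, c) \<in> cells (tile_at f (r, c))"
    using tile_at_in_tiles[OF assms(1) z] assms(3) by auto
  then have "tile_at f (r, c) = tile_at g (r, c)" using tile_at_cell[OF assms(2)] by metis
  then show ?thesis
    using tatami_fieldD[OF assms(1,4,5)] tatami_fieldD[OF assms(2,4,5)]
    by (auto split: dir.splits)
qed

section \<open>Uniform lines\<close>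

text \<open>
\<alpha> tells which antidiagonals r + c point north-east, \<beta> which diagonals r + (n - 1 - c) point
north-west. Two northward arrows make a cell point up, and so on; where that direction leaves the
grid there is a monomino.
\<close>

definition arrow_field :: "nat \<Rightarrow> (nat \<Rightarrow> bool) \<Rightarrow> (nat \<Rightarrow> bool) \<Rightarrow> nat \<Rightarrow> nat \<Rightarrow> dir" where
  "arrow_field n \<alpha> \<beta> r c =
    (if \<alpha> (r + c)
     then if \<beta> (r + (n - 1 - c)) then if r = 0 then Mono else Up
          else if c = n - 1 then Mono else Rt
     else if \<beta> (r + (n - 1 - c)) then if c = 0 then Mono else Lf
          else if r = n - 1 then Mono else Dn)"

text \<open>
Excess 0 means that exactly one end of each line points inward; then the propagation starting from
the other end reaches all cells but that end. The south-west end of the antidiagonal decides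
which of the two ends it is.
\<close>

lemma uniform_antidiagonal:
  assumes t: "tatami_field (Suc (Suc n)) f" and z: "excess n f = 0"
    and rc: "r < Suc (Suc n)" "c < Suc (Suc n)" "0 < r + c" "r + c < 2 * Suc n"
    and e: "e = (f (min (r + c) (Suc n)) (r + c - Suc n) \<in> {Rt, Up})"
  shows "if e then f r c \<in> {Rt, Up} \<or> f r c = Mono \<and> (r = 0 \<or> c = Suc n)
         else f r c \<in> {Lf, Dn} \<or> f r c = Mono \<and> (c = 0 \<or> r = Suc n)"
proof -
  define a where "a = r + c - Suc n"
  define k where "k = min (r + c) (Suc n) - a"
  define i where "i = c - a"
  have ak: "a + k < Suc (Suc n)" "0 < k" "min (r + c) (Suc n) = a + k" "r = a + k - i" "c = a + i" "i \<le> k"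
    and a: "a = 0 \<or> a + k = Suc n"
    unfolding a_def k_def i_def using rc by auto
  have one: "f (a + k) a \<notin> {Rt, Up} \<or> f a (a + k) \<notin> {Lf, Dn}"
  proof (cases "a = 0")
    case True
    then show ?thesis
      using line_end_points_outward(1)[OF t z, of "k - 1"] line_end_points_outward(5)[OF t z] ak(1,2)
      by (cases "k = Suc n") auto
  next
    case False
    then show ?thesis
      using line_end_points_outward(2)[OF t z, of "a - 1"] ak(1,2) a by auto
  qed
  note w = antidiagonal_word[OF t ak(1), of i]
  have e': "e = (f (a + k) a \<in> {Rt, Up})" using e ak(3) by (simp add: a_def)
  have full: "f r c \<in> {Rt, Up} \<or> f r c \<in> {Lf, Dn} \<or> f r c = Mono" by (cases "f r c") auto
  show ?thesis
  proof (cases e)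
    case True
    then have ne: "f a (a + k) \<notin> {Lf, Dn}" using one e' by blast
    show ?thesis
    proof (cases "i = k")
      case True
      then have "r = a" "c = a + k" using ak by auto
      then show ?thesis using ne full a \<open>e\<close> by auto
    next
      case False
      then show ?thesis using w(2)[OF ne] ak \<open>e\<close> by auto
    qed
  next
    case False
    then have ne: "f (a + k) a \<notin> {Rt, Up}" using e' by blast
    show ?thesis
    proof (cases "i = 0")
      case True
      then have "r = a + k" "c = a" using ak by auto
      then show ?thesis using ne full a \<open>\<not> e\<close> by auto
    next
      case i: False
      then show ?thesis using w(1)[OF ne] ak False by auto
    qed
  qed
qed

lemma uniform_diagonal:
  assumes t: "tatami_field (Suc (Suc n)) f" and z: "excess n f = 0"
    and rc: "r < Suc (Suc n)" "c < Suc (Suc n)" and q: "q = r + (Suc n - c)"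
    and q': "0 < q" "q < 2 * Suc n"
    and e: "e = (f (min q (Suc n)) (Suc n - (q - Suc n)) \<in> {Lf, Up})"
  shows "if e then f r c \<in> {Lf, Up} \<or> f r c = Mono \<and> (r = 0 \<or> c = 0)
         else f r c \<in> {Rt, Dn} \<or> f r c = Mono \<and> (r = Suc n \<or> c = Suc n)"
proof -
  define a where "a = q - Suc n"
  define b where "b = Suc n - q"
  define k where "k = min q (Suc n) - a"
  define i where "i = r - a"
  have ak: "a + k < Suc (Suc n)" "b + k < Suc (Suc n)" "0 < k" "min q (Suc n) = a + k"
      "Suc n - (q - Suc n) = b + k" "r = a + i" "c = b + i" "i \<le> k"
    and a: "b = 0 \<and> a + k = Suc n \<or> a = 0 \<and> b + k = Suc n"
    unfolding a_def k_def i_def b_def using rc q' unfolding q by auto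
  have one: "f a b \<notin> {Rt, Dn} \<or> f (a + k) (b + k) \<notin> {Lf, Up}"
  proof (cases "a = 0")
    case a0: True
    show ?thesis
    proof (cases "b = 0")
      case True
      then show ?thesis using a0 a line_end_points_outward(6)[OF t z] by auto
    next
      case False
      then show ?thesis using a0 a line_end_points_outward(4)[OF t z, of "b - 1"] ak(3)
        by (auto simp: Suc_diff_Suc dest: arg_cong[where f = "\<lambda>x. x - b"])
    qed
  next
    case False
    then have "b = 0" "k = n - (a - 1)" "a - 1 < n" using a ak(3) by auto
    then show ?thesis
      using line_end_points_outward(3)[OF t z, of "a - 1"] a False by auto
  qed
  note w = diagonal_word[OF t ak(1,2), of i]
  have e': "e = (f (a + k) (b + k) \<in> {Lf, Up})" using e ak(4,5) by simp
  have full: "f r c \<in> {Rt, Dn} \<or> f r c \<in> {Lf, Up} \<or> f r c = Mono" by (cases "f r c") auto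
  show ?thesis
  proof (cases e)
    case True
    then have ne: "f a b \<notin> {Rt, Dn}" using one e' by blast
    show ?thesis
    proof (cases "i = 0")
      case True
      then show ?thesis using ne full a ak(6,7) \<open>e\<close> by auto
    next
      case False
      then show ?thesis using w(1)[OF ne] ak(6-8) \<open>e\<close> by auto
    qed
  next
    case False
    then have ne: "f (a + k) (b + k) \<notin> {Lf, Up}" using e' by blast
    show ?thesis
    proof (cases "i = k")
      case True
      then show ?thesis using ne full a ak(6,7) \<open>\<not> e\<close> by auto
    next
      case i: False
      then show ?thesis using w(2)[OF ne] ak(6-8) False by auto
    qed
  qed
qed

text \<open>
The square has side N + 2 here; the inner square has at most N monominoes, so n monominoes leave no
room for excess. A monomino can only stand at the end of both its lines to which these point, and
this forces it to be where the combined direction leaves the grid. The monominoes in the top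
corners are ends of the central lines, which therefore point north.
\<close>

lemma maximal_field_is_arrow_field:
  assumes t: "tatami_field n f" and n: "2 \<le> n" and m: "mono_count n f = int n"
    and corner: "f 0 0 = Mono" "f 0 (n - 1) = Mono"
  obtains \<alpha> \<beta> where "\<alpha> (n - 1)" "\<beta> (n - 1)"
    and "\<And>r c. r < n \<Longrightarrow> c < n \<Longrightarrow> f r c = arrow_field n \<alpha> \<beta> r c"
proof -
  obtain N where N: "n = Suc (Suc N)" using n by (metis add_2_eq_Suc le_Suc_ex)
  note t = t[unfolded N]
  have z: "excess N f = 0"
    using mono_count_frame[OF t] excess_nonneg[OF t] mono_count_le[OF tatami_field_inner[OF t]] m
    unfolding N by simp
  \<comment> \<open>The arrow of an antidiagonal is read off at its south-west end, that of a diagonal at its south-east end.\<close>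
  define \<alpha> where "\<alpha> s \<longleftrightarrow> f (min s (Suc N)) (s - Suc N) \<in> {Rt, Up}" for s
  define \<beta> where "\<beta> q \<longleftrightarrow> f (min q (Suc N)) (Suc N - (q - Suc N)) \<in> {Lf, Up}" for q
  note A = uniform_antidiagonal[OF t z _ _ _ _ \<alpha>_def[unfolded atomize_eq]]
  note B = uniform_diagonal[OF t z _ _ refl _ _ \<beta>_def[unfolded atomize_eq]]
  have "\<alpha> (Suc N)" using line_end_points_inward(5)[OF t] corner by (auto simp: \<alpha>_def N)
  moreover have \<beta>1: "\<beta> (Suc N)" using line_end_points_inward(6)[OF t] corner by (auto simp: \<beta>_def)
  moreover have "f r c = arrow_field (Suc (Suc N)) \<alpha> \<beta> r c" if rc: "r < Suc (Suc N)" "c < Suc (Suc N)" for r c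
  proof -
    note D = tatami_fieldD[OF t rc]
    have "r = 0 \<and> c = 0 \<or> r = 0 \<and> c = Suc N \<or> r = Suc N \<and> c = 0 \<or> r = Suc N \<and> c = Suc N
      \<or> 0 < r + c \<and> r + c < 2 * Suc N \<and> 0 < r + (Suc N - c) \<and> r + (Suc N - c) < 2 * Suc N"
      using rc by (cases "r = 0"; cases "c = 0"; cases "r = Suc N"; cases "c = Suc N") auto
    then consider "r = 0" "c = 0" | "r = 0" "c = Suc N" | "r = Suc N" "c = 0" | "r = Suc N" "c = Suc N"
      | "0 < r + c" "r + c < 2 * Suc N" "0 < r + (Suc N - c)" "r + (Suc N - c) < 2 * Suc N"
      by metis
    then show ?thesis
    proof cases
      case 1
      then show ?thesis using corner \<beta>1 by (simp add: arrow_field_def)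
    next
      case 2
      then show ?thesis using corner \<open>\<alpha> (Suc N)\<close> N by (simp add: arrow_field_def)
    next
      case 3
      have "f r c \<in> {Rt, Up}" using 3 \<open>\<alpha> (Suc N)\<close> by (simp add: \<alpha>_def)
      moreover have "\<beta> (2 * Suc N) \<longleftrightarrow> f r c \<in> {Lf, Up}" using 3 by (simp add: \<beta>_def)
      ultimately show ?thesis using 3 \<open>\<alpha> (Suc N)\<close> by (auto simp: arrow_field_def mult_2)
    next
      case 4
      have "f r c \<in> {Lf, Up}" using 4 \<beta>1 by (simp add: \<beta>_def)
      moreover have "\<alpha> (2 * Suc N) \<longleftrightarrow> f r c \<in> {Rt, Up}" using 4 by (simp add: \<alpha>_def)
      ultimately show ?thesis using 4 \<beta>1 by (auto simp: arrow_field_def mult_2)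
    next
      case 5
      show ?thesis
        using A[OF rc 5(1,2)] B[OF rc 5(3,4)] D
        by (cases "f r c") (auto simp: arrow_field_def split: if_splits)
    qed
  qed
  ultimately show thesis using that[of \<alpha> \<beta>] by (simp add: N)
qed

section \<open>Bands of antidiagonals\<close>

text \<open>
Antidiagonals 2t - 1 and 2t form a band. Its member 2t meets the square in 2t + 1 cells if 2t < n
and in 2n - 1 - 2t cells otherwise; the length is the number of dominoes that flipping the band
creates. Lengths are even if 2t < n and odd otherwise, so they determine the band.
\<close>

definition band_length :: "nat \<Rightarrow> nat \<Rightarrow> nat" where
  "band_length n s = (let u = 2 * ((s + 1) div 2) in if u < n then u else 2 * n - 1 - u)"

text \<open>
X holds the lengths of the flipped antidiagonal bands, Y those of the flipped diagonal bands.
\<close>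

definition flips :: "nat \<Rightarrow> (nat set \<times> nat set) set" where
  "flips n = {(X, Y). X \<subseteq> {1..n - 2} \<and> Y \<subseteq> {1..n - 2} \<and> (\<forall>a\<in>X. \<forall>b\<in>Y. a + b \<le> n - 2)}"

text \<open>
Without flips the arrows alternate, the central line n - 1 pointing north; this is the covering by
horizontal dominoes if n is even and by vertical dominoes if n is odd.
\<close>

definition flipped_arrow :: "nat \<Rightarrow> nat set \<Rightarrow> nat \<Rightarrow> bool" where
  "flipped_arrow n X s \<longleftrightarrow> odd (s + n) \<noteq> (band_length n s \<in> X)"

lemma band_cases:
  obtains t where "s = 2 * t \<or> s + 1 = 2 * t" "(s + 1) div 2 = t"
    "band_length n s = (if 2 * t < n then 2 * t else 2 * n - 1 - 2 * t)"
proof -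
  have "s = 2 * ((s + 1) div 2) \<or> s + 1 = 2 * ((s + 1) div 2)" by presburger
  then show thesis using that[of "(s + 1) div 2"] unfolding band_length_def Let_def by blast
qed

lemma band_length_pair:
  assumes "0 < t"
  shows "band_length n (2 * t - 1) = band_length n (2 * t)"
proof -
  have "(2 * t - 1 + 1) div 2 = t" "(2 * t + 1) div 2 = t" using assms by simp_all
  then show ?thesis unfolding band_length_def by simp
qed

lemma band_length_eqD:
  assumes eq: "band_length n s = band_length n s'" and s: "s \<le> 2 * n - 2" "s' \<le> 2 * n - 2" "0 < n"
  shows "(s + 1) div 2 = (s' + 1) div 2"
proof -
  obtain t where t: "s = 2 * t \<or> s + 1 = 2 * t" "(s + 1) div 2 = t"
    "band_length n s = (if 2 * t < n then 2 * t else 2 * n - 1 - 2 * t)" by (rule band_cases)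
  obtain u where u: "s' = 2 * u \<or> s' + 1 = 2 * u" "(s' + 1) div 2 = u"
    "band_length n s' = (if 2 * u < n then 2 * u else 2 * n - 1 - 2 * u)" by (rule band_cases)
  have le: "2 * t \<le> 2 * n - 1" "2 * u \<le> 2 * n - 1" using t(1) u(1) s by linarith+
  have odd: "2 * a \<noteq> 2 * n - 1 - 2 * b" if "2 * b \<le> 2 * n - 1" for a b
  proof
    assume "2 * a = 2 * n - 1 - 2 * b"
    then have "2 * n = 2 * (a + b) + 1" using that \<open>0 < n\<close> by simp
    then show False by (metis dvd_triv_left even_plus_one_iff)
  qed
  have "t = u" using eq le s(3) odd[of u t] odd[of t u] unfolding t(3) u(3) by (simp split: if_splits)
  then show ?thesis using t u by simp
qed

lemma band_length_bounds:
  assumes "1 \<le> s" "s \<le> 2 * n - 2"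
  shows "1 \<le> band_length n s" "band_length n s \<le> n - 1"
proof -
  obtain t where t: "s = 2 * t \<or> s + 1 = 2 * t"
    "band_length n s = (if 2 * t < n then 2 * t else 2 * n - 1 - 2 * t)" by (rule band_cases)
  have "0 < t" using t(1) assms(1) by auto
  moreover have "2 * t \<le> 2 * n - 1" using t(1) assms by auto
  then have "t < n" using assms by simp
  ultimately show "1 \<le> band_length n s" "band_length n s \<le> n - 1" using t by (auto split: if_splits)
qed

lemma band_length_0: "0 < n \<Longrightarrow> band_length n 0 = 0"
  by (simp add: band_length_def)

lemma band_length_central:
  assumes "0 < n"
  shows "band_length n (n - 1) = n - 1"
proof -
  obtain t where t: "n - 1 = 2 * t \<or> n - 1 + 1 = 2 * t"
    "band_length n (n - 1) = (if 2 * t < n then 2 * t else 2 * n - 1 - 2 * t)" by (rule band_cases)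
  then show ?thesis using assms by (auto split: if_splits)
qed

text \<open>
A band of length a consists of the lines at distance n - 1 - a and n - a from the central one, on
one side of it, and the line indices p and q of a cell satisfy
\<bar>p - (n - 1)\<bar> + \<bar>q - (n - 1)\<bar> \<le> n - 1.
\<close>

lemma crossing_bands_are_long:
  assumes "r < n" "c < n"
  shows "n - 1 \<le> band_length n (r + c) + band_length n (r + (n - 1 - c))"
proof -
  define q where "q = r + (n - 1 - c)"
  obtain t where t: "r + c = 2 * t \<or> r + c + 1 = 2 * t"
    "band_length n (r + c) = (if 2 * t < n then 2 * t else 2 * n - 1 - 2 * t)" by (rule band_cases)
  obtain u where u: "q = 2 * u \<or> q + 1 = 2 * u"
    "band_length n q = (if 2 * u < n then 2 * u else 2 * n - 1 - 2 * u)" by (rule band_cases)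
  have sum: "r + c + q + 1 = 2 * r + n" "r + c + n = 2 * c + q + 1" using assms by (simp_all add: q_def)
  have "2 * t \<le> 2 * n - 1" "2 * u \<le> 2 * n - 1" using t(1) u(1) sum assms by auto
  then have "n - 1 \<le> band_length n (r + c) + band_length n q"
    unfolding t(2) u(2) using t(1) u(1) sum assms by (auto split: if_split)
  then show ?thesis by (simp add: q_def)
qed

text \<open>
The cell on antidiagonal p and diagonal q has row (p + q - (n - 1)) / 2 and column
(p - q + (n - 1)) / 2. The parity of n decides which members of the bands 2t - 1, 2t and
2u - 1, 2u meet in a cell; of the two possible choices one that is closest to the centre is in the
square.
\<close>

lemma long_bands_cross:
  assumes s: "1 \<le> s" "s \<le> 2 * n - 2" and s': "1 \<le> s'" "s' \<le> 2 * n - 2"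
    and ge: "n - 1 \<le> band_length n s + band_length n s'"
  obtains r c where "r < n" "c < n" "band_length n (r + c) = band_length n s"
    "band_length n (r + (n - 1 - c)) = band_length n s'"
proof -
  obtain t where t: "s = 2 * t \<or> s + 1 = 2 * t" "(s + 1) div 2 = t"
    "band_length n s = (if 2 * t < n then 2 * t else 2 * n - 1 - 2 * t)" by (rule band_cases)
  obtain u where u: "s' = 2 * u \<or> s' + 1 = 2 * u" "(s' + 1) div 2 = u"
    "band_length n s' = (if 2 * u < n then 2 * u else 2 * n - 1 - 2 * u)" by (rule band_cases)
  have "0 < t" "0 < u" "2 * t \<le> 2 * n - 1" "2 * u \<le> 2 * n - 1" using t(1) u(1) s s' by auto
  then have tu: "0 < t" "0 < u" "t < n" "u < n" by simp_all
  have band: "band_length n p = band_length n s" if "(p + 1) div 2 = t" for p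
    using that t(2) unfolding band_length_def by simp
  have band': "band_length n p = band_length n s'" if "(p + 1) div 2 = u" for p
    using that u(2) unfolding band_length_def by simp
  note ge' = ge[unfolded t(3) u(3)]
  consider (e1) m where "n = 2 * m" "t \<le> u" | (e2) m where "n = 2 * m" "u < t"
    | (o1) m where "n = 2 * m + 1" "t + u \<le> 2 * m" | (o2) m where "n = 2 * m + 1" "2 * m < t + u"
    by (metis oddE evenE linorder_not_le)
  then show thesis
  proof cases
    case e1
    then have b: "m \<le> t + u" "u \<le> t + m" "t + u < 3 * m"
      using ge' tu by (simp_all split: if_splits)
    define r c where "r = t + u - m" and "c = t + m - u"
    have "r + c = 2 * t" "r + (n - 1 - c) = 2 * u - 1" "r < n" "c < n"
      unfolding r_def c_def using b e1 tu by simp_all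
    then show ?thesis using that[of r c] band[of "r + c"] band'[of "r + (n - 1 - c)"] tu by simp
  next
    case e2
    then have b: "m \<le> t + u" "t \<le> u + m" "t + u < 3 * m"
      using ge' tu by (simp_all split: if_splits)
    \<comment> \<open>Antidiagonal 2t - 1 meets diagonal 2u; in the preceding case antidiagonal 2t meets diagonal 2u - 1.\<close>
    define r c where "r = t + u - m" and "c = t + m - 1 - u"
    have "r + c = 2 * t - 1" "r + (n - 1 - c) = 2 * u" "r < n" "c < n"
      unfolding r_def c_def using b e2 tu by simp_all
    then show ?thesis using that[of r c] band[of "r + c"] band'[of "r + (n - 1 - c)"] tu by simp
  next
    case o1
    then have b: "m \<le> t + u" "t \<le> u + m" "u \<le> t + m"
      using ge' tu by (simp_all split: if_splits)
    define r c where "r = t + u - m" and "c = t + m - u"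
    have "r + c = 2 * t" "r + (n - 1 - c) = 2 * u" "r < n" "c < n"
      unfolding r_def c_def using b o1 tu by simp_all
    then show ?thesis using that[of r c] band[of "r + c"] band'[of "r + (n - 1 - c)"] tu by simp
  next
    case o2
    then have b: "t + u \<le> 3 * m + 1" "t \<le> u + m" "u \<le> t + m"
      using ge' tu by (simp_all split: if_splits)
    define r c where "r = t + u - 1 - m" and "c = t + m - u"
    have "r + c = 2 * t - 1" "r + (n - 1 - c) = 2 * u - 1" "r < n" "c < n"
      unfolding r_def c_def using b o2 tu by simp_all
    then show ?thesis using that[of r c] band[of "r + c"] band'[of "r + (n - 1 - c)"] tu by simp
  qed
qed

section \<open>From arrow fields to flipped bands\<close>

text \<open>
The central diagonal points north-west, so its cell (r, r) points up or left, according to its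
antidiagonal 2r; the other half of its domino lies on antidiagonal 2r - 1 and points the opposite
way. The central antidiagonal does the same for the diagonals.
\<close>

lemma arrow_field_band:
  assumes t: "tatami_field n (arrow_field n \<alpha> \<beta>)" and c: "\<alpha> (n - 1)" "\<beta> (n - 1)"
    and r: "0 < r" "r < n"
  shows "\<alpha> (2 * r - 1) \<noteq> \<alpha> (2 * r)" and "\<beta> (2 * r - 1) \<noteq> \<beta> (2 * r)"
proof -
  have q: "r + (n - 1 - r) = n - 1" "r - 1 + (n - 1 - r) = n - 2" "r - 1 + r = 2 * r - 1"
    "r + (n - 1 - (r - 1)) = n" using r by auto
  note D = tatami_fieldD[OF t]
  show "\<alpha> (2 * r - 1) \<noteq> \<alpha> (2 * r)"
  proof (cases "\<alpha> (2 * r)")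
    case True
    then have "arrow_field n \<alpha> \<beta> r r = Up" using q(1) c r by (simp add: arrow_field_def mult_2)
    then have "arrow_field n \<alpha> \<beta> (r - 1) r = Dn" using D(4)[of r r] r by auto
    then show ?thesis using True q(3) by (auto simp: arrow_field_def split: if_splits)
  next
    case False
    then have "arrow_field n \<alpha> \<beta> r r = Lf" using q(1) c r by (simp add: arrow_field_def mult_2)
    then have "arrow_field n \<alpha> \<beta> r (r - 1) = Rt" using D(2)[of r r] r by auto
    moreover have "r + (r - 1) = 2 * r - 1" using r by simp
    ultimately show ?thesis using False by (auto simp: arrow_field_def split: if_splits)
  qed
  define k where "k = n - 1 - r"
  have k: "r + k = n - 1" "k < n" "r + (n - 1 - k) = 2 * r" "r - 1 + (n - 1 - k) = 2 * r - 1"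
    "r + (n - 1 - Suc k) = 2 * r - 1" "k \<noteq> n - 1" unfolding k_def using r by simp_all
  show "\<beta> (2 * r - 1) \<noteq> \<beta> (2 * r)"
  proof (cases "\<beta> (2 * r)")
    case True
    then have "arrow_field n \<alpha> \<beta> r k = Up" using k(1,3) c r by (simp add: arrow_field_def)
    then have "arrow_field n \<alpha> \<beta> (r - 1) k = Dn" using D(4)[of r k] r k(2) by auto
    then show ?thesis using True k(4) by (auto simp: arrow_field_def split: if_splits)
  next
    case False
    then have "arrow_field n \<alpha> \<beta> r k = Rt" using k(1,3,6) c r by (simp add: arrow_field_def)
    then have "arrow_field n \<alpha> \<beta> r (Suc k) = Lf" using D(1)[of r k] r k(2) by auto
    then show ?thesis using False k(5) by (auto simp: arrow_field_def split: if_splits)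
  qed
qed

text \<open>
A doubly flipped cell has the orientation of the unflipped covering, but with the two halves of
each domino exchanged. So its domino lies in its row (n even) or column (n odd), and the other half
is doubly flipped as well; the next cell beyond a domino belongs to the same two bands. Hence
double flips spread along the row or column, which contains a cell of the central antidiagonal.
\<close>

lemma no_crossing:
  assumes t: "tatami_field n (arrow_field n \<alpha> \<beta>)"
    and x: "\<And>s. x s \<longleftrightarrow> \<alpha> s \<noteq> odd (s + n)" and y: "\<And>s. y s \<longleftrightarrow> \<beta> s \<noteq> odd (s + n)"
    and xb: "\<And>r. 0 < r \<Longrightarrow> r < n \<Longrightarrow> x (2 * r - 1) = x (2 * r)"
    and yb: "\<And>r. 0 < r \<Longrightarrow> r < n \<Longrightarrow> y (2 * r - 1) = y (2 * r)"
    and c: "\<not> x (n - 1)" and rc: "r < n" "c < n"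
  shows "\<not> (x (r + c) \<and> y (r + (n - 1 - c)))"
proof
  assume B: "x (r + c) \<and> y (r + (n - 1 - c))"
  note D = tatami_fieldD[OF t]
  have xp: "x (s + 1) = x s" if "odd s" "s + 1 < 2 * n" for s
    using xb[of "(s + 1) div 2"] that by (auto elim!: oddE)
  have yp: "y (s + 1) = y s" if "odd s" "s + 1 < 2 * n" for s
    using yb[of "(s + 1) div 2"] that by (auto elim!: oddE)
  show False
  proof (cases "even n")
    case even: True
    \<comment> \<open>Column m is where row r meets the central antidiagonal; the double flips spread to it.\<close>
    define m where "m = n - 1 - r"
    have right: "x (r + Suc c) \<and> y (r + (n - 1 - Suc c))"
      if B: "x (r + c) \<and> y (r + (n - 1 - c))" and cm: "c < m" for c
    proof -
      have lt: "Suc c < n" "r + c + 1 < n" using cm unfolding m_def by simp_all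
      define p q where "p = r + c" and "q = r + (n - 1 - Suc c)"
      have pq: "r + c = p" "r + Suc c = p + 1" "r + (n - 1 - c) = q + 1" "r + (n - 1 - Suc c) = q"
        "q + 1 < 2 * n" "p + q + 2 = 2 * r + n"
        unfolding p_def q_def using lt by simp_all
      have par: "odd q \<longleftrightarrow> odd p" using even arg_cong[OF pq(6), of even] by simp
      show ?thesis
      proof (cases "odd p")
        case True
        then show ?thesis using B xp[of p] yp[of q] par pq lt unfolding p_def[symmetric] by simp
      next
        case False
        then have "arrow_field n \<alpha> \<beta> r c = Rt"
          using B lt par even unfolding pq x y arrow_field_def by simp
        then have "arrow_field n \<alpha> \<beta> r (Suc c) = Lf" using D(1)[of r c] lt rc by simp
        then show ?thesis using False even par unfolding arrow_field_def pq x y by (simp split: if_splits)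
      qed
    qed
    have left: "x (r + c) \<and> y (r + (n - 1 - c))"
      if B: "x (r + Suc c) \<and> y (r + (n - 1 - Suc c))" and cm: "m \<le> c" "Suc c < n" for c
    proof -
      define p q where "p = r + c" and "q = r + (n - 1 - Suc c)"
      have pq: "r + Suc c = p + 1" "r + c = p" "r + (n - 1 - Suc c) = q" "r + (n - 1 - c) = q + 1"
        "q + 1 < 2 * n" "p + q + 2 = 2 * r + n" "p + 1 < 2 * n"
        unfolding p_def q_def using cm rc by simp_all
      have par: "odd q \<longleftrightarrow> odd p" using even arg_cong[OF pq(6), of even] by simp
      show ?thesis
      proof (cases "odd p")
        case True
        then show ?thesis using B xp[of p] yp[of q] par pq(5,7) unfolding pq(1-4) by simp
      next
        case False
        then have "arrow_field n \<alpha> \<beta> r (Suc c) = Lf"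
          using B par even unfolding pq x y arrow_field_def by simp
        then have "arrow_field n \<alpha> \<beta> r c = Rt" using D(2)[of r "Suc c"] cm rc by auto
        then show ?thesis using False even par unfolding arrow_field_def pq x y by (simp split: if_splits)
      qed
    qed
    have "x (r + m) \<and> y (r + (n - 1 - m))"
    proof (cases "c \<le> m")
      case True
      then show ?thesis by (induction rule: dec_induct) (use B right in blast)+
    next
      case False
      then have "m \<le> c" by simp
      then show ?thesis by (induction rule: inc_induct) (use B left rc in auto)
    qed
    then show False using c rc by (simp add: m_def)
  next
    case odd: False
    \<comment> \<open>Row m is where column c meets the central antidiagonal.\<close>
    define m where "m = n - 1 - c"
    have down: "x (Suc r + c) \<and> y (Suc r + (n - 1 - c))"
      if B: "x (r + c) \<and> y (r + (n - 1 - c))" and rm: "r < m" for r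
    proof -
      have lt: "Suc r < n" "Suc r + c < n" using rm unfolding m_def by simp_all
      define p q where "p = r + c" and "q = r + (n - 1 - c)"
      have pq: "r + c = p" "Suc r + c = p + 1" "r + (n - 1 - c) = q" "Suc r + (n - 1 - c) = q + 1"
        "q + 1 < 2 * n" "p + q + 1 = 2 * r + n" "p + 1 < 2 * n"
        unfolding p_def q_def using lt rc(2) by simp_all
      have par: "odd q \<longleftrightarrow> odd p" using odd arg_cong[OF pq(6), of even] by simp
      show ?thesis
      proof (cases "odd p")
        case True
        then show ?thesis using B xp[of p] yp[of q] par pq(5,7) unfolding pq(1-4) by simp
      next
        case False
        then have "arrow_field n \<alpha> \<beta> r c = Dn"
          using B lt par odd unfolding pq x y arrow_field_def by simp
        then have "arrow_field n \<alpha> \<beta> (Suc r) c = Up" using D(3)[of r c] lt rc(2) by simp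
        then show ?thesis using False odd par unfolding arrow_field_def pq x y by (simp split: if_splits)
      qed
    qed
    have up: "x (r + c) \<and> y (r + (n - 1 - c))"
      if B: "x (Suc r + c) \<and> y (Suc r + (n - 1 - c))" and rm: "m \<le> r" "Suc r < n" for r
    proof -
      define p q where "p = r + c" and "q = r + (n - 1 - c)"
      have pq: "r + c = p" "Suc r + c = p + 1" "r + (n - 1 - c) = q" "Suc r + (n - 1 - c) = q + 1"
        "q + 1 < 2 * n" "p + q + 1 = 2 * r + n" "p + 1 < 2 * n"
        unfolding p_def q_def using rm rc(2) by simp_all
      have par: "odd q \<longleftrightarrow> odd p" using odd arg_cong[OF pq(6), of even] by simp
      show ?thesis
      proof (cases "odd p")
        case True
        then show ?thesis using B xp[of p] yp[of q] par pq(5,7) unfolding pq(1-4) by simp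
      next
        case False
        then have "arrow_field n \<alpha> \<beta> (Suc r) c = Up"
          using B par odd unfolding pq x y arrow_field_def by simp
        then have "arrow_field n \<alpha> \<beta> r c = Dn" using D(4)[of "Suc r" c] rm rc(2) by auto
        then show ?thesis using False odd par unfolding arrow_field_def pq x y by (simp split: if_splits)
      qed
    qed
    have "x (m + c) \<and> y (m + (n - 1 - c))"
    proof (cases "r \<le> m")
      case True
      then show ?thesis by (induction rule: dec_induct) (use B down in blast)+
    next
      case False
      then have "m \<le> r" by simp
      then show ?thesis by (induction rule: inc_induct) (use B up rc in auto)
    qed
    then show False using c rc by (simp add: m_def)
  qed
qed

text \<open>
Being flipped is constant on bands and a band is determined by its length, so the flips are encoded
by sets of lengths. If lengths a and b with a + b \<ge> n - 1 both occurred, there would be a doubly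
flipped cell.
\<close>

lemma arrow_field_is_flipped:
  assumes t: "tatami_field n (arrow_field n \<alpha> \<beta>)" and c: "\<alpha> (n - 1)" "\<beta> (n - 1)" and n: "2 \<le> n"
  obtains X Y where "(X, Y) \<in> flips n"
    "\<And>r c. r < n \<Longrightarrow> c < n \<Longrightarrow> arrow_field n \<alpha> \<beta> r c = arrow_field n (flipped_arrow n X) (flipped_arrow n Y) r c"
proof -
  \<comment> \<open>The lines whose arrow differs from the unflipped one.\<close>
  define x where "x = (\<lambda>s. \<alpha> s \<noteq> odd (s + n))"
  define y where "y = (\<lambda>s. \<beta> s \<noteq> odd (s + n))"
  have central: "\<not> x (n - 1)" "\<not> y (n - 1)" using c n by (auto simp: x_def y_def)
  have odd1: "odd (2 * r - 1 + n) \<longleftrightarrow> \<not> odd (2 * r + n)" if "0 < r" for r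
    using that by simp
  have xb: "\<forall>r. 0 < r \<longrightarrow> r < n \<longrightarrow> x (2 * r - 1) = x (2 * r)"
    using arrow_field_band(1)[OF t c] odd1 unfolding x_def by blast
  have yb: "\<forall>r. 0 < r \<longrightarrow> r < n \<longrightarrow> y (2 * r - 1) = y (2 * r)"
    using arrow_field_band(2)[OF t c] odd1 unfolding y_def by blast
  have band: "z s = z (2 * ((s + 1) div 2))"
    if z: "\<forall>r. 0 < r \<longrightarrow> r < n \<longrightarrow> z (2 * r - 1) = z (2 * r)" and s: "1 \<le> s" "s \<le> 2 * n - 2"
    for z :: "nat \<Rightarrow> bool" and s
  proof (cases "even s")
    case False
    then obtain r where "s = 2 * r + 1" by (elim oddE)
    then show ?thesis using z[rule_format, of "r + 1"] s by simp
  qed simp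
  define lengths where "lengths z = band_length n ` {s. 1 \<le> s \<and> s \<le> 2 * n - 2 \<and> z s}" for z
  have mem: "z s \<longleftrightarrow> band_length n s \<in> lengths z"
    if z: "\<forall>r. 0 < r \<longrightarrow> r < n \<longrightarrow> z (2 * r - 1) = z (2 * r)" and s: "1 \<le> s" "s \<le> 2 * n - 2"
    for z :: "nat \<Rightarrow> bool" and s
  proof
    assume "band_length n s \<in> lengths z"
    then obtain s' where s': "band_length n s = band_length n s'" "1 \<le> s'" "s' \<le> 2 * n - 2" "z s'"
      unfolding lengths_def by auto
    have "(s + 1) div 2 = (s' + 1) div 2" using band_length_eqD[OF s'(1) s(2) s'(3)] n by simp
    then show "z s" using band[where z = z, OF z s] band[where z = z, OF z s'(2,3)] s'(4) by simp
  qed (use s in \<open>auto simp: lengths_def\<close>)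
  have sub: "lengths z \<subseteq> {1..n - 2}"
    if z: "\<forall>r. 0 < r \<longrightarrow> r < n \<longrightarrow> z (2 * r - 1) = z (2 * r)" and zc: "\<not> z (n - 1)" for z
  proof -
    have "band_length n (n - 1) \<notin> lengths z" using mem[where z = z, OF z, of "n - 1"] zc n by simp
    then have "n - 1 \<notin> lengths z" using band_length_central n by simp
    moreover have "lengths z \<subseteq> {1..n - 1}" using band_length_bounds by (auto simp: lengths_def)
    moreover have "{1..n - 1} - {n - 1} \<subseteq> {1..n - 2}" by auto
    ultimately show ?thesis by blast
  qed
  note memx = mem[where z = x, OF xb] and memy = mem[where z = y, OF yb]
  note subx = sub[where z = x, OF xb central(1)] and suby = sub[where z = y, OF yb central(2)]
  have "a + b \<le> n - 2" if ab: "a \<in> lengths x" "b \<in> lengths y" for a b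
  proof (rule ccontr)
    assume "\<not> a + b \<le> n - 2"
    moreover obtain s s' where s: "1 \<le> s" "s \<le> 2 * n - 2" "a = band_length n s"
      and s': "1 \<le> s'" "s' \<le> 2 * n - 2" "b = band_length n s'"
      using ab unfolding lengths_def by auto
    ultimately have "n - 1 \<le> band_length n s + band_length n s'" by simp
    then obtain r c where rc: "r < n" "c < n" "band_length n (r + c) = a"
      "band_length n (r + (n - 1 - c)) = b"
      using long_bands_cross[OF s(1,2) s'(1,2)] s(3) s'(3) by metis
    have "0 < a" "0 < b" using ab subx suby by auto
    then have "r + c \<noteq> 0" "r + (n - 1 - c) \<noteq> 0"
      using rc(3,4) band_length_0[of n] n by (metis less_numeral_extra(3) zero_less_numeral less_le_trans)+
    then have b: "1 \<le> r + c" "r + c \<le> 2 * n - 2" "1 \<le> r + (n - 1 - c)" "r + (n - 1 - c) \<le> 2 * n - 2"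
      using rc(1,2) by linarith+
    have "x (r + c) \<and> y (r + (n - 1 - c))"
      unfolding memx[OF b(1,2)] memy[OF b(3,4)] rc(3,4) using ab by blast
    then show False
      using no_crossing[OF t, of x y r c] xb yb central(1) rc(1,2) unfolding x_def y_def by blast
  qed
  then have "(lengths x, lengths y) \<in> flips n" using subx suby by (auto simp: flips_def)
  moreover have "arrow_field n \<alpha> \<beta> r c = arrow_field n (flipped_arrow n (lengths x)) (flipped_arrow n (lengths y)) r c"
    if rc: "r < n" "c < n" for r c
  proof -
    have \<alpha>: "\<alpha> s = flipped_arrow n (lengths x) s" if "1 \<le> s" "s \<le> 2 * n - 2" for s
      using memx[OF that] unfolding x_def flipped_arrow_def by blast
    have \<beta>: "\<beta> s = flipped_arrow n (lengths y) s" if "1 \<le> s" "s \<le> 2 * n - 2" for s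
      using memy[OF that] unfolding y_def flipped_arrow_def by blast
    consider "r = 0" "c = 0" | "r = 0" "c = n - 1" | "1 \<le> r + c" "1 \<le> r + (n - 1 - c)"
      using rc by linarith
    then show ?thesis
    proof cases
      case 1
      then show ?thesis using c(2) \<beta>[of "n - 1"] n by (simp add: arrow_field_def)
    next
      case 2
      then show ?thesis using c(1) \<alpha>[of "n - 1"] n by (simp add: arrow_field_def)
    next
      case 3
      then show ?thesis using \<alpha>[of "r + c"] \<beta>[of "r + (n - 1 - c)"] rc by (simp add: arrow_field_def)
    qed
  qed
  ultimately show thesis using that by blast
qed

section \<open>From flipped bands to tatami fields\<close>

lemma tatami_field_cong:
  assumes "\<And>r c. r < n \<Longrightarrow> c < n \<Longrightarrow> f r c = g r c"
  shows "tatami_field n f \<longleftrightarrow> tatami_field n g"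
proof -
  have "tatami_field n g'" if "tatami_field n f'" and eq: "\<And>r c. r < n \<Longrightarrow> c < n \<Longrightarrow> f' r c = g' r c"
    for f' g'
    unfolding tatami_field_def
  proof (intro allI impI conjI)
    fix r c assume rc: "r < n" "c < n"
    note D = tatami_fieldD[OF that(1) rc]
    show "g' r c = Rt \<Longrightarrow> Suc c < n" "g' r c = Rt \<Longrightarrow> g' r (Suc c) = Lf"
      using D(1) eq rc by (metis)+
    show "g' r c = Dn \<Longrightarrow> Suc r < n" "g' r c = Dn \<Longrightarrow> g' (Suc r) c = Up"
      using D(3) eq rc by (metis)+
    show "g' r c = Lf \<Longrightarrow> \<exists>c'. c = Suc c' \<and> g' r c' = Rt"
      using D(2) eq rc by (metis Suc_lessD)
    show "g' r c = Up \<Longrightarrow> \<exists>r'. r = Suc r' \<and> g' r' c = Dn"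
      using D(4) eq rc by (metis Suc_lessD)
    show "g' r c \<in> {Rt, Dn} \<or> g' (Suc r) (Suc c) \<in> {Lf, Up}" if "Suc r < n" "Suc c < n"
      using tatami_field_diagonal[OF \<open>tatami_field n f'\<close> that] eq rc that by metis
  qed
  then show ?thesis using assms by metis
qed

lemma mono_count_cong:
  assumes "\<And>r c. r < n \<Longrightarrow> c < n \<Longrightarrow> f r c = g r c"
  shows "mono_count n f = mono_count n g"
  unfolding mono_count_def by (intro sum.cong refl) (simp add: assms)

lemma arrow_field_directions:
  "arrow_field n \<alpha> \<beta> r c \<in> {Rt, Up} \<Longrightarrow> \<alpha> (r + c)"
  "arrow_field n \<alpha> \<beta> r c \<in> {Lf, Dn} \<Longrightarrow> \<not> \<alpha> (r + c)"
  "arrow_field n \<alpha> \<beta> r c \<in> {Lf, Up} \<Longrightarrow> \<beta> (r + (n - 1 - c))"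
  "arrow_field n \<alpha> \<beta> r c \<in> {Rt, Dn} \<Longrightarrow> \<not> \<beta> (r + (n - 1 - c))"
  by (auto simp: arrow_field_def split: if_splits)

text \<open>
Both ends of a line follow the same arrow, so at most one of them points inward.
\<close>

lemma excess_arrow_field:
  assumes t: "tatami_field (Suc (Suc n)) (arrow_field (Suc (Suc n)) \<alpha> \<beta>)"
  shows "excess n (arrow_field (Suc (Suc n)) \<alpha> \<beta>) = 0"
proof -
  define f where "f = arrow_field (Suc (Suc n)) \<alpha> \<beta>"
  note a = arrow_field_directions[of "Suc (Suc n)" \<alpha> \<beta>, folded f_def]
  have 1: "\<not> (f (Suc j) 0 \<in> {Rt, Up} \<and> f 0 (Suc j) \<in> {Lf, Dn})" for j
    using a(1)[of "Suc j" 0] a(2)[of 0 "Suc j"] unfolding add_0_left add_0_right by blast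
  have 2: "\<not> (f (Suc n) (Suc j) \<in> {Rt, Up} \<and> f (Suc j) (Suc n) \<in> {Lf, Dn})" for j
    using a(1)[of "Suc n" "Suc j"] a(2)[of "Suc j" "Suc n"] unfolding add.commute[of "Suc n"] by blast
  have 3: "\<not> (f (Suc j) 0 \<in> {Rt, Dn} \<and> f (Suc n) (n - j) \<in> {Lf, Up})" if "j < n" for j
  proof -
    have "Suc n + (Suc (Suc n) - 1 - (n - j)) = Suc j + (Suc (Suc n) - 1 - 0)" using that by simp
    then show ?thesis using a(4)[of "Suc j" 0] a(3)[of "Suc n" "n - j"] by metis
  qed
  have 4: "\<not> (f 0 (Suc j) \<in> {Rt, Dn} \<and> f (n - j) (Suc n) \<in> {Lf, Up})" for j
  proof -
    have "n - j + (Suc (Suc n) - 1 - Suc n) = 0 + (Suc (Suc n) - 1 - Suc j)" by simp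
    then show ?thesis using a(4)[of 0 "Suc j"] a(3)[of "n - j" "Suc n"] by metis
  qed
  have 5: "\<not> (f (Suc n) 0 \<in> {Rt, Up} \<and> f 0 (Suc n) \<in> {Lf, Dn})"
    using a(1)[of "Suc n" 0] a(2)[of 0 "Suc n"] unfolding add_0_left add_0_right by blast
  have 6: "\<not> (f 0 0 \<in> {Rt, Dn} \<and> f (Suc n) (Suc n) \<in> {Lf, Up})"
  proof -
    have "Suc n + (Suc (Suc n) - 1 - Suc n) = 0 + (Suc (Suc n) - 1 - 0)" by simp
    then show ?thesis using a(4)[of 0 0] a(3)[of "Suc n" "Suc n"] by metis
  qed
  have "(\<Sum>j<n. of_bool (f (Suc j) 0 \<in> {Rt, Dn} \<and> f (Suc n) (n - j) \<in> {Lf, Up})) = (0 :: int)"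
    by (rule sum.neutral) (unfold of_bool_eq_0_iff, use 3 in blast)
  then show ?thesis
    unfolding excess_eq[OF t] unfolding f_def[symmetric]
    by (simp only: 1 2 4 5 6 of_bool_eq(1) sum.neutral_const lessThan_iff add_0 cong: sum.cong_simp)
qed

lemma inner_arrow_field:
  assumes "r < n" "c < n"
  shows "inner n (arrow_field (Suc (Suc n)) \<alpha> \<beta>) r c
    = arrow_field n (\<lambda>s. \<alpha> (s + 2)) (\<lambda>s. \<beta> (s + 2)) r c"
proof -
  have i: "Suc r + Suc c = r + c + 2" "Suc r + (Suc (Suc n) - 1 - Suc c) = r + (n - 1 - c) + 2"
    using assms by simp_all
  define A B where "A = \<alpha> (r + c + 2)" and "B = \<beta> (r + (n - 1 - c) + 2)"
  have e: "c = n - 1 \<longleftrightarrow> Suc c = n" "r = n - 1 \<longleftrightarrow> Suc r = n" using assms by auto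
  show ?thesis
    unfolding inner_def arrow_field_def[of "Suc (Suc n)"] i Let_def arrow_field_def[of n] A_def[symmetric] B_def[symmetric] e
    using assms by simp
qed

text \<open>
The inner square carries an arrow field again, so the frames contribute two monominoes each, down
to a single monomino or nothing.
\<close>

lemma mono_count_arrow_field:
  assumes "tatami_field n (arrow_field n \<alpha> \<beta>)"
  shows "mono_count n (arrow_field n \<alpha> \<beta>) = int n"
  using assms
proof (induction n arbitrary: \<alpha> \<beta> rule: induct_nat_012)
  case 0
  then show ?case by (simp add: mono_count_def)
next
  case 1
  then show ?case by (simp add: mono_count_def arrow_field_def)
next
  case (ge2 n)
  let ?g = "arrow_field n (\<lambda>s. \<alpha> (s + 2)) (\<lambda>s. \<beta> (s + 2))"
  have "tatami_field n ?g"
    using tatami_field_inner[OF ge2.prems] tatami_field_cong[of n "inner n (arrow_field (Suc (Suc n)) \<alpha> \<beta>)" ?g] inner_arrow_field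
    by blast
  then have "mono_count n (inner n (arrow_field (Suc (Suc n)) \<alpha> \<beta>)) = int n"
    using ge2.IH(1) mono_count_cong[of n "inner n (arrow_field (Suc (Suc n)) \<alpha> \<beta>)" ?g] inner_arrow_field
    by metis
  then show ?case
    using mono_count_frame[OF ge2.prems] excess_arrow_field[OF ge2.prems] by simp
qed

lemma flipped_no_crossing:
  assumes "(X, Y) \<in> flips n" "r < n" "c < n"
  shows "\<not> (band_length n (r + c) \<in> X \<and> band_length n (r + (n - 1 - c)) \<in> Y)"
proof
  assume *: "band_length n (r + c) \<in> X \<and> band_length n (r + (n - 1 - c)) \<in> Y"
  then have "1 \<le> band_length n (r + c)"
    "band_length n (r + c) + band_length n (r + (n - 1 - c)) \<le> n - 2"
    using assms(1) by (auto simp: flips_def)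
  then show False using crossing_bands_are_long[OF assms(2,3)] by linarith
qed

text \<open>
A cell that is not flipped at all points along its row (n even) or column (n odd), and so does its
neighbour in that direction, which belongs to the same bands. A cell flipped in one way points to a
neighbour on another band of the other kind, which is not flipped because flipped bands do not
cross. The tatami condition holds since neighbouring cells of a diagonal follow the same arrow.
\<close>

lemma tatami_flipped:
  assumes XY: "(X, Y) \<in> flips n"
  shows "tatami_field n (arrow_field n (flipped_arrow n X) (flipped_arrow n Y))"
proof -
  define f where "f = arrow_field n (flipped_arrow n X) (flipped_arrow n Y)"
  define x where "x = (\<lambda>s. band_length n s \<in> X)"
  define y where "y = (\<lambda>s. band_length n s \<in> Y)"
  have \<alpha>: "flipped_arrow n X s \<longleftrightarrow> odd (s + n) \<noteq> x s" and \<beta>: "flipped_arrow n Y s \<longleftrightarrow> odd (s + n) \<noteq> y s" for s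
    by (auto simp: flipped_arrow_def x_def y_def)
  have nc: "\<not> (x (r + c) \<and> y (r + (n - 1 - c)))" if "r < n" "c < n" for r c
    using flipped_no_crossing[OF XY that] by (simp add: x_def y_def)
  have xp: "odd s \<Longrightarrow> x (s + 1) = x s" and yp: "odd s \<Longrightarrow> y (s + 1) = y s" for s
    using band_length_pair[of "(s + 1) div 2" n] by (auto simp: x_def y_def elim!: oddE)
  have vertical: "f r c = Dn \<longleftrightarrow> f (Suc r) c = Up" if rc: "Suc r < n" "c < n" for r c
  proof -
    define p q where "p = r + c" and "q = r + (n - 1 - c)"
    have pq: "r + c = p" "Suc r + c = p + 1" "r + (n - 1 - c) = q" "Suc r + (n - 1 - c) = q + 1"
      "p + q + 1 = 2 * r + n"
      unfolding p_def q_def using rc by simp_all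
    have par: "(odd p \<noteq> odd q) \<longleftrightarrow> even n" using arg_cong[OF pq(5), of even] by auto
    note n1 = nc[of r c, unfolded pq] and n2 = nc[of "Suc r" c, unfolded pq]
    have f1: "f r c = Dn \<longleftrightarrow> \<not> flipped_arrow n X p \<and> \<not> flipped_arrow n Y q"
      unfolding f_def arrow_field_def pq(1-4) using rc by auto
    have f2: "f (Suc r) c = Up \<longleftrightarrow> flipped_arrow n X (p + 1) \<and> flipped_arrow n Y (q + 1)"
      unfolding f_def arrow_field_def pq(1-4) by simp
    show ?thesis
      unfolding f1 f2 \<alpha> \<beta> using n1 n2 rc par xp[of p] yp[of q]
      by (cases "odd p"; cases "odd q"; cases "x p"; cases "y q") (simp_all, blast?)
  qed
  have horizontal: "f r c = Rt \<longleftrightarrow> f r (Suc c) = Lf" if rc: "r < n" "Suc c < n" for r c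
  proof -
    define p q where "p = r + c" and "q = r + (n - 1 - Suc c)"
    have pq: "r + c = p" "r + Suc c = p + 1" "r + (n - 1 - c) = q + 1" "r + (n - 1 - Suc c) = q"
      "p + q + 2 = 2 * r + n"
      unfolding p_def q_def using rc by simp_all
    have par: "(odd p = odd q) \<longleftrightarrow> even n" using arg_cong[OF pq(5), of even] by auto
    note n1 = nc[of r c, unfolded pq] and n2 = nc[of r "Suc c", unfolded pq]
    have f1: "f r c = Rt \<longleftrightarrow> flipped_arrow n X p \<and> \<not> flipped_arrow n Y (q + 1)"
      unfolding f_def arrow_field_def pq(1-4) using rc by auto
    have f2: "f r (Suc c) = Lf \<longleftrightarrow> \<not> flipped_arrow n X (p + 1) \<and> flipped_arrow n Y q"
      unfolding f_def arrow_field_def pq(1-4) by simp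
    show ?thesis
      unfolding f1 f2 \<alpha> \<beta> using n1 n2 rc par xp[of p] yp[of q]
      by (cases "odd p"; cases "odd q"; cases "x p"; cases "y q") (simp_all, blast?)
  qed
  have edge: "f 0 c \<noteq> Up" "f r 0 \<noteq> Lf" "Suc r = n \<Longrightarrow> f r c \<noteq> Dn" "Suc c = n \<Longrightarrow> f r c \<noteq> Rt" for r c
    by (auto simp: f_def arrow_field_def)
  have "tatami_field n f"
    unfolding tatami_field_def
  proof (intro allI impI conjI)
    fix r c assume rc: "r < n" "c < n"
    show s1: "Suc c < n" if "f r c = Rt" using edge(4)[of c r] that rc by (cases "Suc c = n") auto
    show "f r (Suc c) = Lf" if "f r c = Rt" using s1 that horizontal rc by blast
    show s2: "Suc r < n" if "f r c = Dn" using edge(3)[of r c] that rc by (cases "Suc r = n") auto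
    show "f (Suc r) c = Up" if "f r c = Dn" using s2 that vertical rc by blast
    show "\<exists>c'. c = Suc c' \<and> f r c' = Rt" if "f r c = Lf"
      using edge(2)[of r] horizontal[of r] that rc by (cases c) auto
    show "\<exists>r'. r = Suc r' \<and> f r' c = Dn" if "f r c = Up"
      using edge(1)[of c] vertical[of _ c] that rc by (cases r) auto
    show "f r c \<in> {Rt, Dn} \<or> f (Suc r) (Suc c) \<in> {Lf, Up}" if "Suc r < n" "Suc c < n"
    proof -
      define q where "q = r + (n - 1 - c)"
      have q: "Suc r + (n - 1 - Suc c) = q" "r \<noteq> n - 1" "c \<noteq> n - 1" unfolding q_def using that by auto
      show ?thesis unfolding f_def arrow_field_def q(1) q_def[symmetric] using q(2,3) by simp
    qed
  qed
  then show ?thesis by (simp add: f_def)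
qed

lemma flipped_arrow_central:
  assumes "2 \<le> n" "X \<subseteq> {1..n - 2}"
  shows "flipped_arrow n X (n - 1)"
proof -
  have "n - 1 \<notin> {1..n - 2}" "odd (n - 1 + n)" using assms(1) by auto
  then show ?thesis using assms band_length_central[of n] unfolding flipped_arrow_def by auto
qed

lemma corners_flipped:
  assumes "2 \<le> n" "(X, Y) \<in> flips n"
  shows "arrow_field n (flipped_arrow n X) (flipped_arrow n Y) 0 0 = Mono" "arrow_field n (flipped_arrow n X) (flipped_arrow n Y) 0 (n - 1) = Mono"
proof -
  have "flipped_arrow n X (n - 1)" "flipped_arrow n Y (n - 1)"
    using assms flipped_arrow_central by (auto simp: flips_def)
  then show "arrow_field n (flipped_arrow n X) (flipped_arrow n Y) 0 0 = Mono" "arrow_field n (flipped_arrow n X) (flipped_arrow n Y) 0 (n - 1) = Mono"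
    unfolding arrow_field_def by simp_all
qed

text \<open>
The cells of the central diagonal show the even antidiagonals, those of the central antidiagonal
the even diagonals, and every length belongs to a band with an even member.
\<close>

lemma flipped_inject:
  assumes n: "2 \<le> n" and XY: "(X, Y) \<in> flips n" "(X', Y') \<in> flips n"
    and eq: "\<And>r c. r < n \<Longrightarrow> c < n \<Longrightarrow>
      arrow_field n (flipped_arrow n X) (flipped_arrow n Y) r c = arrow_field n (flipped_arrow n X') (flipped_arrow n Y') r c"
  shows "X = X' \<and> Y = Y'"
proof -
  have central: "flipped_arrow n X (n - 1)" "flipped_arrow n Y (n - 1)" "flipped_arrow n X' (n - 1)" "flipped_arrow n Y' (n - 1)"
    using XY flipped_arrow_central[OF n] by (auto simp: flips_def)
  have a: "flipped_arrow n X (2 * r) = flipped_arrow n X' (2 * r)" if "0 < r" "r < n" for r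
    using eq[of r r] central that by (simp add: arrow_field_def mult_2 split: if_splits)
  have b: "flipped_arrow n Y (2 * r) = flipped_arrow n Y' (2 * r)" if "0 < r" "r < n" for r
  proof -
    define k where "k = n - 1 - r"
    have "r + k = n - 1" "k < n" "r + (n - 1 - k) = 2 * r" "k \<noteq> n - 1"
      unfolding k_def using that by simp_all
    then show ?thesis using eq[of r k] central that by (simp add: arrow_field_def split: if_splits)
  qed
  have surj: "\<exists>r. 0 < r \<and> r < n \<and> band_length n (2 * r) = l" if "l \<in> {1..n - 2}" for l
  proof (cases "even l")
    case True
    then show ?thesis using that by (intro exI[of _ "l div 2"]) (auto simp: band_length_def elim!: evenE)
  next
    case False
    then obtain m where l: "l = 2 * m + 1" by (elim oddE)
    have "\<not> 2 * (n - 1 - m) < n" "0 < n - 1 - m" "n - 1 - m < n" "2 * n - 1 - 2 * (n - 1 - m) = l"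
      using that l by simp_all
    moreover have "(2 * (n - 1 - m) + 1) div 2 = n - 1 - m" by simp
    ultimately show ?thesis by (intro exI[of _ "n - 1 - m"]) (simp only: band_length_def Let_def if_False)
  qed
  have "l \<in> X \<longleftrightarrow> l \<in> X'" "l \<in> Y \<longleftrightarrow> l \<in> Y'" if "l \<in> {1..n - 2}" for l
    using surj[OF that] a b by (auto simp: flipped_arrow_def)
  moreover have "X \<subseteq> {1..n - 2}" "X' \<subseteq> {1..n - 2}" "Y \<subseteq> {1..n - 2}" "Y' \<subseteq> {1..n - 2}"
    using XY by (auto simp: flips_def)
  ultimately show ?thesis by blast
qed

section \<open>Dominoes of the flipped bands\<close>

text \<open>
The even member of a band of length a has exactly a cells outside the top row.
\<close>

lemma card_band_cells:
  assumes X: "X \<subseteq> {1..n - 2}"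
  shows "card {(r, c). r < n \<and> c < n \<and> 0 < r \<and> even (r + c) \<and> band_length n (r + c) \<in> X} = \<Sum>X"
    (is "card ?B = _")
proof -
  have bl: "band_length n s = (if s < n then s else 2 * n - 1 - s)" if "even s" for s
    using that by (auto simp: band_length_def elim!: evenE)
  \<comment> \<open>The even member of the band is antidiagonal a if a is even, and 2n - 1 - a if a is odd.\<close>
  define g where "g = (\<lambda>(a, i). if even a then (i, a - i) else (n - a - 1 + i, n - i))"
  define h where "h = (\<lambda>(r, c). (band_length n (r + c), if r + c < n then r else n - c))"
  have bij: "bij_betw g (Sigma X (\<lambda>a. {1..a})) ?B"
  proof (rule bij_betw_byWitness[where f' = h])
    show "\<forall>z\<in>Sigma X (\<lambda>a. {1..a}). h (g z) = z"
    proof clarify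
      fix a i assume ai: "a \<in> X" "i \<in> {1..a}"
      then have "1 \<le> a" "a \<le> n - 2" using X by auto
      then have a: "1 \<le> a" "a \<le> n - 2" "a < n" by linarith+
      show "h (g (a, i)) = (a, i)"
      proof (cases "even a")
        case True
        then have "g (a, i) = (i, a - i)" "i + (a - i) = a" using ai by (auto simp: g_def)
        then show ?thesis using True a bl[OF True] by (simp add: h_def)
      next
        case False
        then have g: "g (a, i) = (n - a - 1 + i, n - i)" by (simp add: g_def)
        have s: "n - a - 1 + i + (n - i) = 2 * n - 1 - a" "\<not> 2 * n - 1 - a < n"
          "2 * n - 1 - (2 * n - 1 - a) = a" "n - (n - i) = i" using a ai by auto
        have "even (2 * n - 1 - a)" using False a by simp
        then show ?thesis unfolding g h_def using s bl by simp
      qed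
    qed
    show "\<forall>z\<in>?B. g (h z) = z"
    proof clarify
      fix r c assume rc: "r < n" "c < n" "0 < r" "even (r + c)"
      show "g (h (r, c)) = (r, c)"
      proof (cases "r + c < n")
        case True
        then show ?thesis using rc bl[OF rc(4)] by (simp add: g_def h_def)
      next
        case False
        then have b: "band_length n (r + c) = 2 * n - 1 - (r + c)" using bl[OF rc(4)] by simp
        have "odd (2 * n - 1 - (r + c))" using rc by simp
        then show ?thesis using False rc unfolding g_def h_def by (simp add: b)
      qed
    qed
    show "g ` Sigma X (\<lambda>a. {1..a}) \<subseteq> ?B"
    proof (rule image_subsetI)
      fix z assume "z \<in> Sigma X (\<lambda>a. {1..a})"
      then obtain a i where z: "z = (a, i)" and ai: "a \<in> X" "i \<in> {1..a}" by auto
      then have "1 \<le> a" "a \<le> n - 2" using X by auto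
      then have a: "1 \<le> a" "a \<le> n - 2" "a < n" by linarith+
      show "g z \<in> ?B"
      proof (cases "even a")
        case True
        then have "g (a, i) = (i, a - i)" "i + (a - i) = a" using ai by (auto simp: g_def)
        then show ?thesis using True a ai bl[OF True] by (simp add: z)
      next
        case False
        then have g: "g (a, i) = (n - a - 1 + i, n - i)" by (simp add: g_def)
        have s: "n - a - 1 + i + (n - i) = 2 * n - 1 - a" "\<not> 2 * n - 1 - a < n"
          "2 * n - 1 - (2 * n - 1 - a) = a" using a ai by auto
        have "even (2 * n - 1 - a)" using False a by simp
        then have "band_length n (2 * n - 1 - a) = a" using s bl by simp
        then show ?thesis
          unfolding z g mem_Collect_eq prod.case s(1) using \<open>even (2 * n - 1 - a)\<close> a ai by auto
      qed
    qed
    show "h ` ?B \<subseteq> Sigma X (\<lambda>a. {1..a})"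
    proof (rule image_subsetI)
      fix z assume "z \<in> ?B"
      then obtain r c where z: "z = (r, c)"
        and rc: "r < n" "c < n" "0 < r" "even (r + c)" "band_length n (r + c) \<in> X" by auto
      show "h z \<in> Sigma X (\<lambda>a. {1..a})"
      proof (cases "r + c < n")
        case True
        then show ?thesis using rc bl[OF rc(4)] by (simp add: z h_def)
      next
        case False
        then have b: "band_length n (r + c) = 2 * n - 1 - (r + c)" using bl[OF rc(4)] by simp
        have "1 \<le> n - c" "n - c \<le> 2 * n - 1 - (r + c)" using rc(1,2) by linarith+
        then show ?thesis
          using rc(5) unfolding z h_def prod.case if_not_P[OF False] b by (intro SigmaI) simp_all
      qed
    qed
  qed
  have "card ?B = card (Sigma X (\<lambda>a. {1..a}))" by (rule bij_betw_same_card[OF bij, symmetric])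
  also have "\<dots> = \<Sum>X"
  proof -
    have "finite X" using X by (rule finite_subset) simp
    then show ?thesis by (simp add: card_SigmaI)
  qed
  finally show ?thesis .
qed

text \<open>
A vertical domino lies in a unique flipped band. It is counted at its lower half. That half lies on
an even antidiagonal if an antidiagonal band is flipped, and on an even diagonal if a diagonal band
is, as an unflipped even line points south here.
\<close>

lemma card_vdominoes_flipped:
  assumes XY: "(X, Y) \<in> flips n" and n: "even n"
  shows "card (vdominoes (tiles n (arrow_field n (flipped_arrow n X) (flipped_arrow n Y)))) = \<Sum>X + \<Sum>Y"
proof -
  let ?f = "arrow_field n (flipped_arrow n X) (flipped_arrow n Y)"
  note t = tatami_flipped[OF XY]
  define A where "A = {(r, c). r < n \<and> c < n \<and> 0 < r \<and> even (r + c) \<and> band_length n (r + c) \<in> X}"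
  define B where "B = {(r, c). r < n \<and> c < n \<and> 0 < r \<and> even (r + c) \<and> band_length n (r + c) \<in> Y}"
  \<comment> \<open>Reflecting the columns turns antidiagonals into diagonals.\<close>
  define B' where "B' = (\<lambda>(r, c). (r, n - 1 - c)) ` B"
  have fin: "finite A" "finite B" by (rule finite_subset[of _ "{..<n} \<times> {..<n}"]; auto simp: A_def B_def)+
  have up: "?f r c = Up \<longleftrightarrow> (r, c) \<in> A \<or> (r, c) \<in> B'" if rc: "r < n" "c < n" for r c
  proof -
    define p q where "p = r + c" and "q = r + (n - 1 - c)"
    have pq: "p + q + 1 = 2 * r + n" unfolding p_def q_def using rc by simp
    have par: "odd p \<longleftrightarrow> even q" using arg_cong[OF pq, of even] n by auto
    have B': "(r, c) \<in> B' \<longleftrightarrow> 0 < r \<and> even q \<and> band_length n q \<in> Y"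
    proof
      assume "0 < r \<and> even q \<and> band_length n q \<in> Y"
      then have "(r, n - 1 - c) \<in> B" using rc by (auto simp: B_def q_def)
      moreover have "n - 1 - (n - 1 - c) = c" using rc by simp
      ultimately show "(r, c) \<in> B'" unfolding B'_def by force
    next
      assume "(r, c) \<in> B'"
      then obtain c' where c': "c = n - 1 - c'" "(r, c') \<in> B" by (auto simp: B'_def)
      moreover have "q = r + c'" unfolding q_def c'(1) using c'(2) by (auto simp: B_def)
      ultimately show "0 < r \<and> even q \<and> band_length n q \<in> Y" by (simp add: B_def)
    qed
    have A: "(r, c) \<in> A \<longleftrightarrow> 0 < r \<and> even p \<and> band_length n p \<in> X"
      using rc by (simp add: A_def p_def)
    have "?f r c = Up \<longleftrightarrow> 0 < r \<and> flipped_arrow n X p \<and> flipped_arrow n Y q"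
      unfolding arrow_field_def p_def[symmetric] q_def[symmetric] by simp
    then show ?thesis
      unfolding A B' flipped_arrow_def
      using par n flipped_no_crossing[OF XY rc, folded p_def q_def] by (cases "even p") auto
  qed
  have AB: "A \<inter> B' = {}"
  proof -
    have False if "(r, c) \<in> A" "(r, c') \<in> B" "c = n - 1 - c'" for r c c'
    proof -
      have "even (r + c)" "even (r + c')" "c + c' + 1 = n" using that by (auto simp: A_def B_def)
      then show False using n by presburger
    qed
    then show ?thesis by (auto simp: B'_def)
  qed
  have "vdominoes (tiles n ?f) = (\<lambda>(r, c). VDomino (r - 1) c) ` (A \<union> B')"
  proof (intro set_eqI iffI)
    fix u assume "u \<in> vdominoes (tiles n ?f)"
    then obtain r c where u: "u = VDomino r c" "r < n" "c < n" "?f r c = Dn"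
      by (auto simp: vdominoes_def)
    then have "Suc r < n" "?f (Suc r) c = Up" using tatami_fieldD(3)[OF t] by blast+
    then have "(Suc r, c) \<in> A \<union> B'" using up u(3) by blast
    then show "u \<in> (\<lambda>(r, c). VDomino (r - 1) c) ` (A \<union> B')" unfolding u(1) by force
  next
    fix u assume "u \<in> (\<lambda>(r, c). VDomino (r - 1) c) ` (A \<union> B')"
    then obtain r c where u: "u = VDomino (r - 1) c" "(r, c) \<in> A \<union> B'" by auto
    have rc: "r < n" "c < n" using u(2) by (auto simp: A_def B_def B'_def)
    then have "?f r c = Up" using up u(2) by blast
    then obtain r' where "r = Suc r'" "?f r' c = Dn" using tatami_fieldD(4)[OF t rc] by blast
    then show "u \<in> vdominoes (tiles n ?f)" using u rc by (auto simp: vdominoes_def)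
  qed
  moreover have "inj_on (\<lambda>(r, c). VDomino (r - 1) c) (A \<union> B')"
    by (auto simp: inj_on_def A_def B'_def B_def)
  moreover have "inj_on (\<lambda>(r, c). (r, n - 1 - c)) B"
    by (auto simp: inj_on_def B_def)
  moreover have "card A = \<Sum>X" "card B = \<Sum>Y"
    unfolding A_def B_def using XY card_band_cells by (auto simp: flips_def)
  ultimately show ?thesis
    using fin AB by (simp add: card_image B'_def card_Un_disjoint)
qed

text \<open>
The horizontal dominoes are counted at their right halves. For a flipped antidiagonal band these
lie on its even member, since unflipped even lines point north here; for a flipped diagonal band
they lie on its odd member.
\<close>

lemma card_hdominoes_flipped:
  assumes XY: "(X, Y) \<in> flips n" and n: "odd n"
  shows "card (hdominoes (tiles n (arrow_field n (flipped_arrow n X) (flipped_arrow n Y)))) = \<Sum>X + \<Sum>Y"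
proof -
  let ?f = "arrow_field n (flipped_arrow n X) (flipped_arrow n Y)"
  note t = tatami_flipped[OF XY]
  define A where "A = {(r, c). r < n \<and> c < n \<and> 0 < r \<and> even (r + c) \<and> band_length n (r + c) \<in> X}"
  define B where "B = {(r, c). r < n \<and> c < n \<and> 0 < r \<and> even (r + c) \<and> band_length n (r + c) \<in> Y}"
  define A' where "A' = (\<lambda>(r, c). (c, r)) ` A"
  \<comment> \<open>This map takes antidiagonal q + 1, without its cell in the top row, to diagonal q, without its cell in the left column.\<close>
  define B' where "B' = (\<lambda>(r, c). (c, n - r)) ` B"
  have fin: "finite A" "finite B" by (rule finite_subset[of _ "{..<n} \<times> {..<n}"]; auto simp: A_def B_def)+
  have lf: "?f r c = Lf \<longleftrightarrow> (r, c) \<in> A' \<or> (r, c) \<in> B'" if rc: "r < n" "c < n" for r c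
  proof -
    define p q where "p = r + c" and "q = r + (n - 1 - c)"
    have pq: "p + q + 1 = 2 * r + n" unfolding p_def q_def using rc by simp
    have par: "odd p \<longleftrightarrow> odd q" using arg_cong[OF pq, of even] n by auto
    have bq: "band_length n (q + 1) = band_length n q" if "odd q"
      using that band_length_pair[of "(q + 1) div 2" n] by (auto elim!: oddE)
    have B': "(r, c) \<in> B' \<longleftrightarrow> 0 < c \<and> odd q \<and> band_length n q \<in> Y"
    proof
      assume *: "0 < c \<and> odd q \<and> band_length n q \<in> Y"
      have e: "n - c + r = q + 1" "n - (n - c) = c" using rc by (auto simp: q_def)
      have "(n - c, r) \<in> B"
        unfolding B_def mem_Collect_eq prod.case e(1) using rc * bq by simp
      then show "(r, c) \<in> B'" unfolding B'_def using e(2) by force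
    next
      assume "(r, c) \<in> B'"
      then obtain r' where r': "c = n - r'" "(r', r) \<in> B" by (auto simp: B'_def)
      moreover have "q + 1 = r' + r" unfolding q_def r'(1) using r'(2) by (auto simp: B_def)
      ultimately have "even (q + 1)" "band_length n (q + 1) \<in> Y" "r' < n" by (auto simp: B_def)
      then show "0 < c \<and> odd q \<and> band_length n q \<in> Y" using bq r'(1) by simp
    qed
    have A': "(r, c) \<in> A' \<longleftrightarrow> 0 < c \<and> even p \<and> band_length n p \<in> X"
      using rc by (auto simp: A_def A'_def p_def add.commute image_iff)
    have "?f r c = Lf \<longleftrightarrow> 0 < c \<and> \<not> flipped_arrow n X p \<and> flipped_arrow n Y q"
      unfolding arrow_field_def p_def[symmetric] q_def[symmetric] by simp
    then show ?thesis
      unfolding A' B' flipped_arrow_def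
      using par n flipped_no_crossing[OF XY rc, folded p_def q_def] by (cases "even p") auto
  qed
  have AB: "A' \<inter> B' = {}"
  proof -
    have False if "(c, r) \<in> A" "(r', r) \<in> B" "c = n - r'" for r c r'
    proof -
      have "even (c + r)" "even (r' + r)" "c + r' = n" using that by (auto simp: A_def B_def)
      then show False using n by presburger
    qed
    then show ?thesis by (auto simp: A'_def B'_def)
  qed
  have "hdominoes (tiles n ?f) = (\<lambda>(r, c). HDomino r (c - 1)) ` (A' \<union> B')"
  proof (intro set_eqI iffI)
    fix u assume "u \<in> hdominoes (tiles n ?f)"
    then obtain r c where u: "u = HDomino r c" "r < n" "c < n" "?f r c = Rt"
      by (auto simp: hdominoes_def)
    then have "Suc c < n" "?f r (Suc c) = Lf" using tatami_fieldD(1)[OF t] by blast+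
    then have "(r, Suc c) \<in> A' \<union> B'" using lf u(2) by blast
    then show "u \<in> (\<lambda>(r, c). HDomino r (c - 1)) ` (A' \<union> B')" unfolding u(1) by force
  next
    fix u assume "u \<in> (\<lambda>(r, c). HDomino r (c - 1)) ` (A' \<union> B')"
    then obtain r c where u: "u = HDomino r (c - 1)" "(r, c) \<in> A' \<union> B'" by auto
    have rc: "r < n" "c < n" using u(2) by (auto simp: A_def B_def A'_def B'_def)
    then have "?f r c = Lf" using lf u(2) by blast
    then obtain c' where "c = Suc c'" "?f r c' = Rt" using tatami_fieldD(2)[OF t rc] by blast
    then show "u \<in> hdominoes (tiles n ?f)" using u rc by (auto simp: hdominoes_def)
  qed
  moreover have "inj_on (\<lambda>(r, c). HDomino r (c - 1)) (A' \<union> B')"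
    by (auto simp: inj_on_def A'_def A_def B'_def B_def)
  moreover have "inj_on (\<lambda>(r, c). (c, r)) A" "inj_on (\<lambda>(r, c). (c, n - r)) B"
    by (auto simp: inj_on_def B_def)
  moreover have "card A = \<Sum>X" "card B = \<Sum>Y"
    unfolding A_def B_def using XY card_band_cells by (auto simp: flips_def)
  ultimately show ?thesis
    using fin AB by (simp add: card_image A'_def B'_def card_Un_disjoint)
qed

section \<open>Parametrization of the coverings\<close>

lemma T_eq_flips:
  assumes n: "2 \<le> n"
  shows "T n = (\<lambda>(X, Y). tiles n (arrow_field n (flipped_arrow n X) (flipped_arrow n Y))) ` flips n"
proof (intro set_eqI iffI)
  fix P assume "P \<in> T n"
  then have P: "tatami_covering n P" "card (monominoes P) = n" "Monomino 0 0 \<in> P"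
    "Monomino 0 (n - 1) \<in> P"
    by (auto simp: T_def)
  then have cov: "covering n P" by (simp add: tatami_covering_def)
  note t = tatami_field_of[OF P(1)] and eq = tiles_field_of[OF cov]
  have "mono_count n (field_of P) = int n" using monominoes_tiles[of n "field_of P"] eq P(2) by simp
  then obtain \<alpha> \<beta> where c: "\<alpha> (n - 1)" "\<beta> (n - 1)"
    and f: "\<And>r c. r < n \<Longrightarrow> c < n \<Longrightarrow> field_of P r c = arrow_field n \<alpha> \<beta> r c"
    using maximal_field_is_arrow_field[OF t n] field_of_eq(1)[OF cov] P(3,4) by blast
  have t': "tatami_field n (arrow_field n \<alpha> \<beta>)" using t tatami_field_cong[of n "field_of P"] f by blast
  then obtain X Y where XY: "(X, Y) \<in> flips n"
    "\<And>r c. r < n \<Longrightarrow> c < n \<Longrightarrow> arrow_field n \<alpha> \<beta> r c = arrow_field n (flipped_arrow n X) (flipped_arrow n Y) r c"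
    using arrow_field_is_flipped[OF t' c n] by blast
  have "P = tiles n (arrow_field n (flipped_arrow n X) (flipped_arrow n Y))"
    using eq tiles_cong[of n "field_of P" "arrow_field n (flipped_arrow n X) (flipped_arrow n Y)"] f XY(2) by simp
  then show "P \<in> (\<lambda>(X, Y). tiles n (arrow_field n (flipped_arrow n X) (flipped_arrow n Y))) ` flips n"
    using XY(1) by force
next
  fix P assume "P \<in> (\<lambda>(X, Y). tiles n (arrow_field n (flipped_arrow n X) (flipped_arrow n Y))) ` flips n"
  then obtain X Y where XY: "(X, Y) \<in> flips n" and P: "P = tiles n (arrow_field n (flipped_arrow n X) (flipped_arrow n Y))"
    by auto
  note t = tatami_flipped[OF XY]
  show "P \<in> T n"
    unfolding T_def P
    using tatami_covering_tiles[OF t] monominoes_tiles[of n "arrow_field n (flipped_arrow n X) (flipped_arrow n Y)"]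
      mono_count_arrow_field[OF t] corners_flipped[OF n XY] n by simp
qed

lemma inj_on_flips:
  assumes "2 \<le> n"
  shows "inj_on (\<lambda>(X, Y). tiles n (arrow_field n (flipped_arrow n X) (flipped_arrow n Y))) (flips n)"
proof (rule inj_onI, clarify)
  fix X Y X' Y'
  assume XY: "(X, Y) \<in> flips n" "(X', Y') \<in> flips n"
    and eq: "tiles n (arrow_field n (flipped_arrow n X) (flipped_arrow n Y)) = tiles n (arrow_field n (flipped_arrow n X') (flipped_arrow n Y'))"
  show "X = X' \<and> Y = Y'"
    using flipped_inject[OF assms XY] tiles_inject[OF tatami_flipped[OF XY(1)] tatami_flipped[OF XY(2)] eq]
    by blast
qed

text \<open>
The number g of dominoes of one orientation is kept abstract, so that one count serves the
vertical dominoes of even squares and the horizontal dominoes of odd ones.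
\<close>

lemma card_T_by_flips:
  assumes n: "2 \<le> n"
    and count: "\<And>X Y. (X, Y) \<in> flips n \<Longrightarrow> g (tiles n (arrow_field n (flipped_arrow n X) (flipped_arrow n Y))) = \<Sum>X + \<Sum>Y"
  shows "card {P \<in> T n. g P = k} = card {(X, Y) \<in> flips n. \<Sum>X + \<Sum>Y = k}"
proof -
  let ?h = "\<lambda>(X, Y). tiles n (arrow_field n (flipped_arrow n X) (flipped_arrow n Y))"
  have "{P \<in> T n. g P = k} = ?h ` {(X, Y) \<in> flips n. \<Sum>X + \<Sum>Y = k}"
    unfolding T_eq_flips[OF n] using count by force
  moreover have "inj_on ?h {(X, Y) \<in> flips n. \<Sum>X + \<Sum>Y = k}"
    by (rule inj_on_subset[OF inj_on_flips[OF n]]) auto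
  ultimately show ?thesis by (simp add: card_image)
qed

section \<open>Counting compatible pairs of flips\<close>

lemma S_conv_card:
  "S_conv s t m = card {(A, B). A \<subseteq> {1..s} \<and> B \<subseteq> {1..t} \<and> int (\<Sum>A) + int (\<Sum>B) = m}"
proof -
  define I where "I = {(k1, k2). 0 \<le> k1 \<and> 0 \<le> k2 \<and> k1 + k2 = m}"
  define F where "F = (\<lambda>(k1, k2). {A. A \<subseteq> {1..s} \<and> int (\<Sum>A) = k1} \<times> {B. B \<subseteq> {1..t} \<and> int (\<Sum>B) = k2})"
  have "I \<subseteq> {0..m} \<times> {0..m}" by (auto simp: I_def)
  then have finI: "finite I" by (rule finite_subset) simp
  have fin: "finite {A. A \<subseteq> {1..l} \<and> int (\<Sum>A) = k}" for l :: nat and k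
    by (rule finite_subset[of _ "Pow {1..l}"]) auto
  have "S_conv s t m = (\<Sum>k\<in>I. card (F k))"
    unfolding S_conv_def I_def[symmetric]
    by (intro sum.cong refl) (auto simp: F_def S_def card_cartesian_product)
  also have "\<dots> = card (\<Union>k\<in>I. F k)"
    by (subst card_UN_disjoint) (use finI fin in \<open>auto simp: F_def\<close>)
  also have "(\<Union>k\<in>I. F k) = {(A, B). A \<subseteq> {1..s} \<and> B \<subseteq> {1..t} \<and> int (\<Sum>A) + int (\<Sum>B) = m}"
    by (auto simp: I_def F_def sum_nonneg)
  finally show ?thesis .
qed

lemma finite_flips: "finite {(X, Y) \<in> flips n. P X Y}"
proof (rule finite_subset)
  show "{(X, Y) \<in> flips n. P X Y} \<subseteq> Pow {1..n - 2} \<times> Pow {1..n - 2}"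
    by (auto simp: flips_def)
qed simp

text \<open>
If n - i - 1 is the largest element of X, then the other elements of X are an arbitrary subset of
{1..n - i - 2}, and the condition on sums says that Y is a subset of {1..i - 1}.
\<close>

lemma flips_with_max:
  assumes i: "1 \<le> i" "i \<le> (n - 1) div 2" and n: "2 \<le> n"
  shows "card {(X, Y) \<in> flips n. X \<noteq> {} \<and> Max X = n - i - 1 \<and> \<Sum>X + \<Sum>Y = k}
    = S_conv (n - i - 2) (i - 1) (int k - (int n - int i - 1))"
proof -
  define m where "m = n - i - 1"
  have m: "1 \<le> m" "m \<le> n - 2" "n - i - 2 = m - 1" "i - 1 = n - 2 - m" "int n - int i - 1 = int m"
    "n = m + i + 1"
    unfolding m_def using i n by auto
  have fin: "finite A" if "A \<subseteq> {1..l}" for A and l :: nat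
    using that finite_subset by blast
  define Q where "Q = {(A, B). A \<subseteq> {1..m - 1} \<and> B \<subseteq> {1..n - 2 - m} \<and> int (\<Sum>A) + int (\<Sum>B) = int k - int m}"
  have ins: "\<Sum>(insert m A) = m + \<Sum>A" if "A \<subseteq> {1..m - 1}" for A
  proof -
    have "m \<notin> A" using that m(1) by auto
    then show ?thesis using fin[OF that] by simp
  qed
  have "bij_betw (\<lambda>(A, B). (insert m A, B)) Q
    {(X, Y) \<in> flips n. X \<noteq> {} \<and> Max X = m \<and> \<Sum>X + \<Sum>Y = k}"
  proof (rule bij_betw_byWitness[where f' = "\<lambda>(X, Y). (X - {m}, Y)"])
    show "\<forall>z\<in>Q. (\<lambda>(X, Y). (X - {m}, Y)) ((\<lambda>(A, B). (insert m A, B)) z) = z"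
      using m(1) by (auto simp: Q_def)
    show "\<forall>z\<in>{(X, Y) \<in> flips n. X \<noteq> {} \<and> Max X = m \<and> \<Sum>X + \<Sum>Y = k}.
        (\<lambda>(A, B). (insert m A, B)) ((\<lambda>(X, Y). (X - {m}, Y)) z) = z"
    proof (clarify, simp)
      fix X Y assume "(X, Y) \<in> flips n" "X \<noteq> {}" "m = Max X"
      then have "Max X \<in> X" using fin by (intro Max_in) (auto simp: flips_def)
      then show "insert (Max X) X = X" by auto
    qed
    show "(\<lambda>(A, B). (insert m A, B)) ` Q \<subseteq> {(X, Y) \<in> flips n. X \<noteq> {} \<and> Max X = m \<and> \<Sum>X + \<Sum>Y = k}"
    proof (rule image_subsetI)
      fix z assume "z \<in> Q"
      then obtain A B where z: "z = (A, B)" and A: "A \<subseteq> {1..m - 1}" and B: "B \<subseteq> {1..n - 2 - m}"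
        and sum: "int (\<Sum>A) + int (\<Sum>B) = int k - int m" by (auto simp: Q_def)
      have "Max (insert m A) = m"
        using A fin[OF A] by (intro Max_eqI) fastforce+
      moreover have "a + b \<le> n - 2" if "a \<in> insert m A" "b \<in> B" for a b
      proof -
        have "a \<le> m" using that(1) subsetD[OF A] by fastforce
        moreover have "b \<le> n - 2 - m" using that(2) B by auto
        ultimately show ?thesis using m(2) by linarith
      qed
      moreover have "insert m A \<subseteq> {1..n - 2}" "B \<subseteq> {1..n - 2}"
      proof -
        have "{1..m - 1} \<subseteq> {1..n - 2}" "{1..n - 2 - m} \<subseteq> {1..n - 2}" "m \<in> {1..n - 2}"
          using m(1,2) by auto
        then show "insert m A \<subseteq> {1..n - 2}" "B \<subseteq> {1..n - 2}" using A B by blast+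
      qed
      moreover have "\<Sum>(insert m A) + \<Sum>B = k" using ins[OF A] sum by linarith
      ultimately show "(\<lambda>(A, B). (insert m A, B)) z
          \<in> {(X, Y) \<in> flips n. X \<noteq> {} \<and> Max X = m \<and> \<Sum>X + \<Sum>Y = k}"
        unfolding z prod.case mem_Collect_eq flips_def by blast
    qed
    show "(\<lambda>(X, Y). (X - {m}, Y)) ` {(X, Y) \<in> flips n. X \<noteq> {} \<and> Max X = m \<and> \<Sum>X + \<Sum>Y = k} \<subseteq> Q"
    proof (rule image_subsetI)
      fix z assume "z \<in> {(X, Y) \<in> flips n. X \<noteq> {} \<and> Max X = m \<and> \<Sum>X + \<Sum>Y = k}"
      then obtain X Y where z: "z = (X, Y)" and XY: "(X, Y) \<in> flips n" and X: "X \<noteq> {}"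
        and mm: "m = Max X" and k: "k = \<Sum>X + \<Sum>Y" by auto
      have fX: "finite X" using XY fin by (auto simp: flips_def)
      have mX: "m \<in> X" using X fX mm by simp
      have A: "X - {m} \<subseteq> {1..m - 1}"
      proof
        fix a assume a: "a \<in> X - {m}"
        then have "a \<le> m" "1 \<le> a" using fX mm XY by (auto simp: flips_def)
        then show "a \<in> {1..m - 1}" using a by auto
      qed
      have B: "Y \<subseteq> {1..n - 2 - m}"
      proof
        fix b assume "b \<in> Y"
        then have "1 \<le> b" "m + b \<le> n - 2" using XY mX by (auto simp: flips_def)
        then show "b \<in> {1..n - 2 - m}" by auto
      qed
      have "\<Sum>X = m + \<Sum>(X - {m})" using sum.remove[OF fX mX, of "\<lambda>a. a"] by simp
      then show "(\<lambda>(X, Y). (X - {m}, Y)) z \<in> Q"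
        unfolding z prod.case Q_def mem_Collect_eq using A B k by simp
    qed
  qed
  then have "card Q = card {(X, Y) \<in> flips n. X \<noteq> {} \<and> Max X = m \<and> \<Sum>X + \<Sum>Y = k}"
    by (rule bij_betw_same_card)
  then show ?thesis
    unfolding S_conv_card m(3,4,5) m_def[symmetric] Q_def by simp
qed

lemma flips_swap: "(X, Y) \<in> flips n \<longleftrightarrow> (Y, X) \<in> flips n"
  unfolding flips_def by (auto; metis add.commute)

text \<open>
With h = (n - 2) div 2, two elements above h have a sum above n - 2, so at most one of X and Y
contains such an element. If neither does, the condition on sums is void and the last term of W
counts the pairs. The other two cases are symmetric, hence the factor 2.
\<close>

lemma card_flips_eq_W:
  assumes n: "2 \<le> n"
  shows "card {(X, Y) \<in> flips n. \<Sum>X + \<Sum>Y = k} = W n k"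
proof -
  define h where "h = (n - 2) div 2"
  have h: "2 * h \<le> n - 2" "n - 2 < 2 * h + 2" unfolding h_def by presburger+
  define A where "A = {(X, Y) \<in> flips n. \<Sum>X + \<Sum>Y = k}"
  define small where "small = {(X, Y) \<in> A. X \<subseteq> {1..h} \<and> Y \<subseteq> {1..h}}"
  define bigX where "bigX = {(X, Y) \<in> A. \<not> X \<subseteq> {1..h}}"
  define bigY where "bigY = {(X, Y) \<in> A. \<not> Y \<subseteq> {1..h}}"
  define D where "D i = {(X, Y) \<in> flips n. X \<noteq> {} \<and> Max X = n - i - 1 \<and> \<Sum>X + \<Sum>Y = k}" for i
  have finA: "finite A" unfolding A_def by (rule finite_flips)
  have fin: "finite small" "finite bigX" "finite bigY"
    by (rule finite_subset[OF _ finA]; auto simp: small_def bigX_def bigY_def)+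
  have pos: "X \<subseteq> {1..h} \<longleftrightarrow> (\<forall>a\<in>X. a \<le> h)" if "X \<subseteq> {1..n - 2}" for X
    using that by auto
  have "bigX \<inter> bigY = {}"
  proof -
    have False if XY: "(X, Y) \<in> flips n" "\<not> X \<subseteq> {1..h}" "\<not> Y \<subseteq> {1..h}" for X Y
    proof -
      obtain a b where "a \<in> X" "b \<in> Y" "h < a" "h < b"
        using XY pos[of X] pos[of Y] by (auto simp: flips_def not_le)
      moreover have "a + b \<le> n - 2" using XY(1) \<open>a \<in> X\<close> \<open>b \<in> Y\<close> by (auto simp: flips_def)
      ultimately show False using h by linarith
    qed
    then show ?thesis by (auto simp: bigX_def bigY_def A_def)
  qed
  moreover have "small \<inter> (bigX \<union> bigY) = {}" "A = small \<union> (bigX \<union> bigY)"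
    by (auto simp: small_def bigX_def bigY_def)
  ultimately have "card A = card small + (card bigX + card bigY)"
    using fin by (simp add: card_Un_disjoint)
  moreover have "card bigY = card bigX"
  proof -
    have "bigY = prod.swap ` bigX"
      using flips_swap[of _ _ n] by (force simp: bigX_def bigY_def A_def add.commute image_iff)
    then show ?thesis by (simp add: card_image)
  qed
  moreover have "card small = S_conv h h (int k)"
  proof -
    have "(X, Y) \<in> flips n" if "X \<subseteq> {1..h}" "Y \<subseteq> {1..h}" for X Y
    proof -
      have "h \<le> n - 2" using h(1) by simp
      then have "X \<subseteq> {1..n - 2}" "Y \<subseteq> {1..n - 2}" using that by auto
      moreover have "a + b \<le> n - 2" if "a \<in> X" "b \<in> Y" for a b
      proof -
        have "a \<le> h" "b \<le> h" using that \<open>X \<subseteq> {1..h}\<close> \<open>Y \<subseteq> {1..h}\<close> by auto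
        then show ?thesis using h(1) by linarith
      qed
      ultimately show ?thesis by (simp add: flips_def)
    qed
    moreover have "\<Sum>X + \<Sum>Y = k \<longleftrightarrow> int (\<Sum>X) + int (\<Sum>Y) = int k" for X Y
      by (simp only: of_nat_add[symmetric] of_nat_eq_iff)
    ultimately have "small = {(X, Y). X \<subseteq> {1..h} \<and> Y \<subseteq> {1..h} \<and> int (\<Sum>X) + int (\<Sum>Y) = int k}"
      unfolding small_def A_def by blast
    then show ?thesis by (simp add: S_conv_card)
  qed
  moreover have "card bigX = (\<Sum>i = 1..(n - 1) div 2. S_conv (n - i - 2) (i - 1) (int k - (int n - int i - 1)))"
  proof -
    have half: "(n - 1) div 2 = n - 2 - h" by (rule div_nat_eqI) (use h n in auto)
    have "bigX = (\<Union>i\<in>{1..(n - 1) div 2}. D i)"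
    proof (intro set_eqI iffI)
      fix z assume "z \<in> bigX"
      then obtain X Y where z: "z = (X, Y)" "(X, Y) \<in> flips n" "\<Sum>X + \<Sum>Y = k" "\<not> X \<subseteq> {1..h}"
        by (auto simp: bigX_def A_def)
      have X: "X \<subseteq> {1..n - 2}" using z(2) by (auto simp: flips_def)
      then have "finite X" using finite_subset by blast
      moreover obtain a where a: "a \<in> X" "h < a" using z(4) pos[OF X] by (auto simp: not_le)
      ultimately have "a \<le> Max X" "Max X \<in> X" by (auto intro: Max_in)
      then have "h < Max X" "Max X \<le> n - 2" using a X by auto
      then have "n - 1 - Max X \<in> {1..(n - 1) div 2}" "n - (n - 1 - Max X) - 1 = Max X"
        unfolding half by auto
      then show "z \<in> (\<Union>i\<in>{1..(n - 1) div 2}. D i)"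
        using z a(1) by (intro UN_I[of "n - 1 - Max X"]) (auto simp: D_def)
    next
      fix z assume "z \<in> (\<Union>i\<in>{1..(n - 1) div 2}. D i)"
      then obtain i where i: "1 \<le> i" "i \<le> (n - 1) div 2" and "z \<in> D i" by auto
      then obtain X Y where z: "z = (X, Y)" "(X, Y) \<in> flips n"
        "\<Sum>X + \<Sum>Y = k" "X \<noteq> {}" "Max X = n - i - 1"
        by (auto simp: D_def)
      have "finite X" using z(2) finite_subset[of X "{1..n - 2}"] by (auto simp: flips_def)
      then have "Max X \<in> X" using z(4) by simp
      moreover have "h < Max X" using i z(5) n unfolding half by linarith
      ultimately show "z \<in> bigX" using z by (auto simp: bigX_def A_def)
    qed
    then have "card bigX = (\<Sum>i = 1..(n - 1) div 2. card (D i))"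
    proof (simp only:, subst card_UN_disjoint)
      show "\<forall>i\<in>{1..(n - 1) div 2}. finite (D i)"
        unfolding D_def by (intro ballI finite_flips)
      show "\<forall>i\<in>{1..(n - 1) div 2}. \<forall>j\<in>{1..(n - 1) div 2}. i \<noteq> j \<longrightarrow> D i \<inter> D j = {}"
      proof (intro ballI impI)
        fix i j assume "i \<in> {1..(n - 1) div 2}" "j \<in> {1..(n - 1) div 2}" "i \<noteq> j"
        then have "n - i - 1 \<noteq> n - j - 1" unfolding half by auto
        then show "D i \<inter> D j = {}" by (auto simp: D_def)
      qed
    qed auto
    then show ?thesis
      unfolding D_def using flips_with_max[OF _ _ n] by simp
  qed
  ultimately show ?thesis
    unfolding W_def A_def h_def by simp
qed

theorem lemma1:
  fixes n k :: nat
  assumes "n \<ge> 2"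
  shows "(even n \<longrightarrow> V n k = W n k) \<and> (odd n \<longrightarrow> H n k = W n k)"
proof -
  have "V n k = W n k" if "even n"
    unfolding V_def using card_T_by_flips[OF assms card_vdominoes_flipped[OF _ that]] card_flips_eq_W[OF assms]
    by simp
  moreover have "H n k = W n k" if "odd n"
    unfolding H_def using card_T_by_flips[OF assms card_hdominoes_flipped[OF _ that]] card_flips_eq_W[OF assms]
    by simp
  ultimately show ?thesis by blast
qed

end
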